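(* Consider a one-coordinate reduced ensemble with generalized free energy $F_{\mathrm{gen}}(x)=M(x)-T_ES(x)$ depending smoothly on a dimensionless $g$-independent coordinate $x$, satisfying the restricted first law $M'(x)=T_H(x)S'(x)$, so that $$\frac{dF_{\mathrm{gen}}}{dx}=[T_H(x)-T_E]\,S'(x).$$ Let $x_c$ be an ordinary critical point: $T_E=T_c=T_H(x_c)$, $T_H'(x_c)=T_H''(x_c)=0$, with $S'(x_c)$ finite and nonzero and with $T_H'''(x_c)S'(x_c)>0$. Then at $T_E=T_c$, $$F_{\mathrm{gen}}'(x_c)=F_{\mathrm{gen}}''(x_c)=F_{\mathrm{gen}}'''(x_c)=0,\qquad F_{\mathrm{gen}}''''(x_c)=T_H'''(x_c)S'(x_c)>0 .$$ If moreover the semiclassical and regularity assumptions of the context hold with $x_c$ the unique dominant interior minimum, then, writing $F_c=F_{\mathrm{gen}}(x_c)$ and $\bar F_c$ for the normalized average of $F_{\mathrm{gen}}$ at $T_E=T_c$, as $g\to0^+$, $$\bar F_c-F_c=\frac{T_c}{4}+\mathcal O(T_c\,g^{1/2}),$$ and the local partition function scales as $Z_{\mathrm{loc}}\propto g^{1/4}$, i.e. $Z_{\mathrm{loc}}\,e^{F_c/T_c}/\mathcal N(g)=K g^{1/4}[1+o(1)]$ with a constant $K>0$ independent of $g$.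
   Context: Semiclassical and regularity assumptions. The parameter $g\to0^+$ enters through $M=\widehat m/g$ and $S=\widehat s/g$ with $\widehat m,\widehat s$ smooth and independent of $g$. Thus $T_H=M'/S'$ is independent of $g$ and the reduced action $I_E(x)=F_{\mathrm{gen}}(x)/T_E$ equals $1/g$ times a fixed smooth function. The ensemble measure on an interval $\mathcal D$ of values of $x$ is $\mathcal N(g)\rho(x,g)\,dx$. Here $\mathcal N(g)>0$ is independent of $x$, $\rho\ge0$, and near $x_c$, $\rho(x_c+\delta,g)=\rho_0+\rho_1\delta+\mathcal O(\delta^2)$ uniformly in $g$, with $\rho_0>0$ and $\rho_1$ independent of $g$. The normalized average is $\bar F=\int_{\mathcal D}\rho F_{\mathrm{gen}}e^{-I_E}dx\big/\int_{\mathcal D}\rho e^{-I_E}dx$, and $Z_{\mathrm{loc}}=\int_{|x-x_c|<r}\mathcal N(g)\rho e^{-I_E}dx$ for a fixed small $r>0$. "Unique dominant interior minimum" means that $x_c$ is interior to $\mathcal D$ and, for every small $r>0$, there is $c>0$ with $$\int_{\mathcal D\setminus(x_c-r,x_c+r)}\rho\,(1+|I_E-I_E(x_c)|)\,e^{-(I_E-I_E(x_c))}dx=\mathcal O(e^{-c/g}).$$ *)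

theory Defs
  imports "HOL-Analysis.Analysis" "HOL-Library.Landau_Symbols"
begin

definition smooth_fun_on :: "real set \<Rightarrow> (real \<Rightarrow> real) \<Rightarrow> bool" where
  "smooth_fun_on X f \<longleftrightarrow> (\<forall>n. (deriv ^^ n) f differentiable_on X)"

(* The range X of the coordinate is an open interval, so that deriv is the ordinary two-sided
   derivative throughout X. T_H is only tied to M and S by the first law; where S' vanishes
   its value is left unconstrained. *)
definition reduced_ensemble ::
    "real set \<Rightarrow> (real \<Rightarrow> real) \<Rightarrow> (real \<Rightarrow> real) \<Rightarrow> (real \<Rightarrow> real) \<Rightarrow> bool" where
  "reduced_ensemble X M S T\<^sub>H \<longleftrightarrow>
     open X \<and> is_interval X \<and> smooth_fun_on X M \<and> smooth_fun_on X S \<and>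
     (\<forall>x\<in>X. deriv M x = T\<^sub>H x * deriv S x)"

definition F_gen :: "(real \<Rightarrow> real) \<Rightarrow> (real \<Rightarrow> real) \<Rightarrow> real \<Rightarrow> real \<Rightarrow> real" where
  "F_gen M S T\<^sub>E x = M x - T\<^sub>E * S x"

definition ordinary_critical_point ::
    "real set \<Rightarrow> (real \<Rightarrow> real) \<Rightarrow> (real \<Rightarrow> real) \<Rightarrow> real \<Rightarrow> real \<Rightarrow> bool" where
  "ordinary_critical_point X S T\<^sub>H T\<^sub>c x\<^sub>c \<longleftrightarrow>
     x\<^sub>c \<in> X \<and> T\<^sub>c = T\<^sub>H x\<^sub>c \<and> deriv T\<^sub>H x\<^sub>c = 0 \<and> (deriv ^^ 2) T\<^sub>H x\<^sub>c = 0 \<and>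
     deriv S x\<^sub>c \<noteq> 0 \<and> (deriv ^^ 3) T\<^sub>H x\<^sub>c * deriv S x\<^sub>c > 0"

definition euclidean_action :: "(real \<Rightarrow> real) \<Rightarrow> real \<Rightarrow> real \<Rightarrow> real" where
  "euclidean_action F T\<^sub>E x = F x / T\<^sub>E"

(* The expansion of the density at x\<^sub>c is uniform in g: d and C do not depend on g. *)
definition regular_density ::
    "real set \<Rightarrow> real \<Rightarrow> real \<Rightarrow> (real \<Rightarrow> real \<Rightarrow> real) \<Rightarrow> (real \<Rightarrow> real) \<Rightarrow> bool" where
  "regular_density D x\<^sub>c g\<^sub>0 \<rho> N \<longleftrightarrow>
     (\<forall>g\<in>{0<..<g\<^sub>0}. 0 < N g \<and> set_borel_measurable lebesgue D (\<lambda>x. \<rho> x g) \<and>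
        (\<forall>x\<in>D. 0 \<le> \<rho> x g)) \<and>
     (\<exists>\<rho>\<^sub>0>0. \<exists>\<rho>\<^sub>1. \<exists>d>0. \<exists>C. \<forall>g\<in>{0<..<g\<^sub>0}. \<forall>\<delta>. \<bar>\<delta>\<bar> < d \<longrightarrow>
        \<bar>\<rho> (x\<^sub>c + \<delta>) g - (\<rho>\<^sub>0 + \<rho>\<^sub>1 * \<delta>)\<bar> \<le> C * \<delta>\<^sup>2)"

(* The action I takes the parameter g first. Integrability is required explicitly because the
   Lebesgue integral of a non-integrable function is 0 by convention. *)
definition unique_dominant_interior_minimum ::
    "real set \<Rightarrow> real \<Rightarrow> (real \<Rightarrow> real \<Rightarrow> real) \<Rightarrow> (real \<Rightarrow> real \<Rightarrow> real) \<Rightarrow> bool" where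
  "unique_dominant_interior_minimum D x\<^sub>c \<rho> I \<longleftrightarrow>
     x\<^sub>c \<in> interior D \<and>
     (\<forall>\<^sub>F r in at_right 0. \<exists>c>0.
        (\<forall>\<^sub>F g in at_right 0. set_integrable lebesgue (D - {x\<^sub>c - r<..<x\<^sub>c + r})
           (\<lambda>x. \<rho> x g * (1 + \<bar>I g x - I g x\<^sub>c\<bar>) * exp (- (I g x - I g x\<^sub>c)))) \<and>
        (\<lambda>g. LINT x:(D - {x\<^sub>c - r<..<x\<^sub>c + r})|lebesgue.
           \<rho> x g * (1 + \<bar>I g x - I g x\<^sub>c\<bar>) * exp (- (I g x - I g x\<^sub>c)))
          \<in> O[at_right 0](\<lambda>g. exp (- c / g)))"

definition normalized_average ::
    "real set \<Rightarrow> (real \<Rightarrow> real) \<Rightarrow> (real \<Rightarrow> real) \<Rightarrow> real \<Rightarrow> real" where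
  "normalized_average D \<rho> F T\<^sub>E =
     (LINT x:D|lebesgue. \<rho> x * F x * exp (- euclidean_action F T\<^sub>E x)) /
     (LINT x:D|lebesgue. \<rho> x * exp (- euclidean_action F T\<^sub>E x))"

definition Z_loc ::
    "real \<Rightarrow> real \<Rightarrow> real \<Rightarrow> (real \<Rightarrow> real) \<Rightarrow> (real \<Rightarrow> real) \<Rightarrow> real \<Rightarrow> real" where
  "Z_loc x\<^sub>c r n \<rho> F T\<^sub>E =
     (LINT x:{x. \<bar>x - x\<^sub>c\<bar> < r}|lebesgue. n * \<rho> x * exp (- euclidean_action F T\<^sub>E x))"

end

theory Submission
  imports Defs "HOL-Probability.Distributions" "HOL-Real_Asymp.Real_Asymp"
begin

text \<open>
  With \<open>\<phi> = (F - F\<^sub>c) / T\<^sub>c\<close> for the \<open>g\<close>-independent part \<open>F\<close> of the free energy, the Boltzmann weight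
  is \<open>exp (- \<phi> / g)\<close> up to a factor independent of \<open>x\<close>, and the claim on the average says that
  \<open>u = \<phi> / g\<close> has mean \<open>1/4\<close>. At the critical point \<open>\<phi> = \<delta>\<^sup>4 (\<alpha> + \<beta> \<delta> + O(\<delta>\<^sup>2))\<close>, so
  \<open>\<delta>\<close> lives on the scale \<open>w = g powr (1/4)\<close>. For a weight \<open>h(u)\<close> that decays exponentially, a
  second order expansion in \<open>\<delta>\<close> at fixed \<open>t = (\<delta>/w)\<^sup>4\<close> leaves the even leading term \<open>h(\<alpha>t)\<close>, a
  term odd in \<open>\<delta>\<close> that integrates to zero, and a remainder bounded by \<open>\<delta>\<^sup>2 exp (- \<alpha>t/8)\<close>, whose integral
  is \<open>O(w\<^sup>3)\<close>. The choice \<open>h(u) = exp (- u)\<close> gives the partition function. The choice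
  \<open>h(u) = (u - 1/4) exp (- u)\<close> gives the deviation of the mean from \<open>1/4\<close>; its leading integral vanishes,
  because the integrand is the derivative of \<open>- (y/4) exp (- \<alpha>y\<^sup>4)\<close>.
\<close>

section \<open>The thermodynamic potential at an ordinary critical point\<close>

lemma smooth_fun_on_has_derivative:
  assumes "smooth_fun_on X f" "open X" "x \<in> X"
  shows "((deriv ^^ n) f has_real_derivative (deriv ^^ Suc n) f x) (at x)"
proof -
  have "(deriv ^^ n) f differentiable at x within X"
    using assms(1,3) unfolding smooth_fun_on_def differentiable_on_def by blast
  hence "(deriv ^^ n) f differentiable at x"
    unfolding at_within_open[OF assms(3,2)] .
  thus ?thesis by (simp add: DERIV_deriv_iff_real_differentiable)
qed

lemma has_derivative_F_gen:
  assumes "reduced_ensemble X M S T\<^sub>H" "x \<in> X"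
  shows "(F_gen M S T\<^sub>E has_real_derivative (T\<^sub>H x - T\<^sub>E) * deriv S x) (at x)"
proof -
  have "open X" "smooth_fun_on X M" "smooth_fun_on X S"
    using assms(1) by (auto simp: reduced_ensemble_def)
  hence MS: "(M has_real_derivative deriv M x) (at x)" "(S has_real_derivative deriv S x) (at x)"
    using smooth_fun_on_has_derivative[of X M x 0] smooth_fun_on_has_derivative[of X S x 0] assms(2)
    by simp_all
  have "deriv M x = T\<^sub>H x * deriv S x" using assms by (auto simp: reduced_ensemble_def)
  thus ?thesis unfolding F_gen_def
    by (auto intro!: derivative_eq_intros MS simp: algebra_simps)
qed

text \<open>By the first law \<open>F' = (T\<^sub>H - T\<^sub>c) * S'\<close>, so the Leibniz rule
  writes each higher derivative as a combination of \<open>T\<^sub>H - T\<^sub>c\<close> and the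
  derivatives of \<open>T\<^sub>H\<close>. At the critical point all of these vanish up to second
  order, and only the product of the third derivative of \<open>T\<^sub>H\<close> with
  \<open>S'\<close> survives in \<open>F''''\<close>. The work lies in the regularity of
  \<open>T\<^sub>H\<close>, which is not assumed: it is read off from
  \<open>T\<^sub>H = M' / S'\<close>.\<close>

lemma F_gen_ordinary_critical_point:
  assumes ens: "reduced_ensemble X M S T\<^sub>H" and crit: "ordinary_critical_point X S T\<^sub>H T\<^sub>c x\<^sub>c"
  shows "deriv (F_gen M S T\<^sub>c) x\<^sub>c = 0" "(deriv ^^ 2) (F_gen M S T\<^sub>c) x\<^sub>c = 0"
    "(deriv ^^ 3) (F_gen M S T\<^sub>c) x\<^sub>c = 0"
    "(deriv ^^ 4) (F_gen M S T\<^sub>c) x\<^sub>c = (deriv ^^ 3) T\<^sub>H x\<^sub>c * deriv S x\<^sub>c"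
proof -
  define F where "F = F_gen M S T\<^sub>c"
  \<comment> \<open>The quotient \<open>M' / S'\<close> determines \<open>T\<^sub>H\<close> only
    where \<open>S'\<close> is nonzero. This set is open and contains the critical point, so
    derivatives of \<open>T\<^sub>H\<close> at that point can be computed inside it.\<close>
  define U where "U = X \<inter> deriv S -` (- {0})"
  define S' where "S' n = (deriv ^^ n) S" for n
  define M' where "M' n = (deriv ^^ n) M" for n
  define T where "T n = (deriv ^^ n) T\<^sub>H" for n
  have X: "open X" and sm: "smooth_fun_on X M" "smooth_fun_on X S"
    and law: "\<And>x. x \<in> X \<Longrightarrow> deriv M x = T\<^sub>H x * deriv S x"
    using ens by (auto simp: reduced_ensemble_def)
  have c: "x\<^sub>c \<in> X" "T\<^sub>c = T\<^sub>H x\<^sub>c" "T 1 x\<^sub>c = 0" "T 2 x\<^sub>c = 0" "deriv S x\<^sub>c \<noteq> 0"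
    using crit by (auto simp: ordinary_critical_point_def T_def)
  have UX: "U \<subseteq> X" by (auto simp: U_def)
  have dS: "(S' n has_real_derivative S' (Suc n) x) (at x)" if "x \<in> X" for n x
    using smooth_fun_on_has_derivative[OF sm(2) X that] by (simp add: S'_def)
  have dM: "(M' n has_real_derivative M' (Suc n) x) (at x)" if "x \<in> X" for n x
    using smooth_fun_on_has_derivative[OF sm(1) X that] by (simp add: M'_def)
  have S1: "deriv S = S' 1" "deriv M = M' 1" by (simp_all add: S'_def M'_def)
  have "continuous_on X (deriv S)"
    unfolding S1 by (rule DERIV_continuous_on[OF has_field_derivative_at_within[OF dS]])
  hence U: "open U"
    unfolding U_def using X by (intro continuous_open_preimage) auto
  have cU: "x\<^sub>c \<in> U" using c by (simp add: U_def)
  have S0: "S' 1 x \<noteq> 0" if "x \<in> U" for x using that by (simp add: U_def S1)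
  have deriv_on: "(deriv ^^ Suc n) f x = d"
    if "x \<in> U" "\<And>y. y \<in> U \<Longrightarrow> (deriv ^^ n) f y = h y" "(h has_real_derivative d) (at x)"
    for f h :: "real \<Rightarrow> real" and x d n
  proof -
    have "((deriv ^^ n) f has_real_derivative d) (at x)"
      by (rule has_field_derivative_transform_within_open[OF that(3) U that(1)]) (simp add: that(2))
    thus ?thesis by (simp add: DERIV_imp_deriv)
  qed
  \<comment> \<open>The number \<open>d\<close> does not occur in the conclusion: any closed form
    \<open>h\<close> that agrees with \<open>T n\<close> on \<open>U\<close> and is differentiable
    makes \<open>T n\<close> differentiable, and its derivative is then \<open>T (Suc n)\<close> by
    definition. When the rule is applied, \<open>d\<close> is left to unification.\<close>
  have transfer: "(T n has_real_derivative T (Suc n) x) (at x)"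
    if "x \<in> U" "\<And>y. y \<in> U \<Longrightarrow> T n y = h y" "(h has_real_derivative d) (at x)" for h x d n
  proof -
    have "(T n has_real_derivative d) (at x)"
      by (rule has_field_derivative_transform_within_open[OF that(3) U that(1)]) (simp add: that(2))
    thus ?thesis by (simp add: DERIV_imp_deriv T_def)
  qed
  have T0: "T 0 y = M' 1 y / S' 1 y" if "y \<in> U" for y
    using law[of y] that UX S0[OF that] by (auto simp: T_def S1)
  have dT0: "(T 0 has_real_derivative T 1 x) (at x)" if "x \<in> U" for x
    unfolding One_nat_def
    by (rule transfer[OF that T0])
      (use that UX S0[OF that] in \<open>auto intro!: DERIV_divide dM dS\<close>)
  \<comment> \<open>The quotient rule is restated with \<open>T 0\<close> in place of
    \<open>M' / S'\<close>, so that the next differentiation can reuse \<open>dT0\<close>;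
    \<open>T2\<close> continues the same recursion.\<close>
  have T1: "T 1 y = (M' 2 y - T 0 y * S' 2 y) / S' 1 y" if "y \<in> U" for y
  proof -
    have "((\<lambda>x. M' 1 x / S' 1 x) has_real_derivative
        (M' (Suc 1) y * S' 1 y - M' 1 y * S' (Suc 1) y) / (S' 1 y * S' 1 y)) (at y)"
      by (rule DERIV_divide) (use that UX S0[OF that] in \<open>auto intro!: dM dS\<close>)
    from deriv_on[OF that _ this, of 0 T\<^sub>H] T0
    have "T 1 y = (M' 2 y * S' 1 y - M' 1 y * S' 2 y) / (S' 1 y * S' 1 y)"
      by (simp add: T_def numeral_2_eq_2)
    thus ?thesis using S0[OF that] by (simp add: T0[OF that] field_simps)
  qed
  have dT1: "(T 1 has_real_derivative T 2 x) (at x)" if "x \<in> U" for x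
  proof -
    have "(T 1 has_real_derivative T (Suc 1) x) (at x)"
      by (rule transfer[OF that T1], assumption)
        (rule DERIV_divide DERIV_diff DERIV_mult dM dS dT0 S0 that subsetD[OF UX])+
    thus ?thesis by (simp add: numeral_2_eq_2)
  qed
  have T2: "T 2 y = ((M' 3 y - (T 1 y * S' 2 y + S' 3 y * T 0 y)) * S' 1 y
      - (M' 2 y - T 0 y * S' 2 y) * S' 2 y) / (S' 1 y * S' 1 y)" if "y \<in> U" for y
  proof -
    have "((\<lambda>x. (M' 2 x - T 0 x * S' 2 x) / S' 1 x) has_real_derivative
        ((M' (Suc 2) y - (T 1 y * S' 2 y + S' (Suc 2) y * T 0 y)) * S' 1 y
          - (M' 2 y - T 0 y * S' 2 y) * S' (Suc 1) y) / (S' 1 y * S' 1 y)) (at y)"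
      by (rule DERIV_divide DERIV_diff DERIV_mult dM dS dT0 S0 that subsetD[OF UX])+
    from deriv_on[OF that _ this, of 1 T\<^sub>H] T1 show ?thesis
      by (simp add: T_def numeral_2_eq_2 numeral_3_eq_3)
  qed
  have dT2: "(T 2 has_real_derivative T 3 x) (at x)" if "x \<in> U" for x
  proof -
    have "(T 2 has_real_derivative T (Suc 2) x) (at x)"
      by (rule transfer[OF that T2], assumption)
        (rule DERIV_divide DERIV_diff DERIV_mult DERIV_add dM dS dT0 dT1 S0 that subsetD[OF UX]
          mult_not_zero no_zero_divisors)+
    thus ?thesis by (simp add: eval_nat_numeral)
  qed
  have F1: "(deriv ^^ 1) F x = (T 0 x - T\<^sub>c) * S' 1 x" if "x \<in> U" for x
    using DERIV_imp_deriv[OF has_derivative_F_gen[OF ens, of x T\<^sub>c]] that UX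
    by (auto simp: F_def T_def S'_def)
  have F2: "(deriv ^^ 2) F x = T 1 x * S' 1 x + (T 0 x - T\<^sub>c) * S' 2 x" if "x \<in> U" for x
  proof -
    have "((\<lambda>x. (T 0 x - T\<^sub>c) * S' 1 x) has_real_derivative
        (T 1 x - 0) * S' 1 x + S' (Suc 1) x * (T 0 x - T\<^sub>c)) (at x)"
      by (rule DERIV_mult DERIV_diff DERIV_const dS dT0 that subsetD[OF UX])+
    from deriv_on[OF that F1 this] show ?thesis by (simp add: numeral_2_eq_2 mult.commute)
  qed
  have F3: "(deriv ^^ 3) F x = T 2 x * S' 1 x + 2 * T 1 x * S' 2 x + (T 0 x - T\<^sub>c) * S' 3 x"
    if "x \<in> U" for x
  proof -
    have "((\<lambda>x. T 1 x * S' 1 x + (T 0 x - T\<^sub>c) * S' 2 x) has_real_derivative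
        (T 2 x * S' 1 x + S' (Suc 1) x * T 1 x)
          + ((T 1 x - 0) * S' 2 x + S' (Suc 2) x * (T 0 x - T\<^sub>c))) (at x)"
      by (rule DERIV_add DERIV_mult DERIV_diff DERIV_const dS dT0 dT1 that subsetD[OF UX])+
    from deriv_on[OF that F2 this] show ?thesis
      by (simp add: numeral_2_eq_2 numeral_3_eq_3 algebra_simps)
  qed
  have F4: "(deriv ^^ 4) F x = T 3 x * S' 1 x + 3 * T 2 x * S' 2 x + 3 * T 1 x * S' 3 x
      + (T 0 x - T\<^sub>c) * S' 4 x" if "x \<in> U" for x
  proof -
    have "((\<lambda>x. T 2 x * S' 1 x + 2 * T 1 x * S' 2 x + (T 0 x - T\<^sub>c) * S' 3 x) has_real_derivative
        (T 3 x * S' 1 x + S' (Suc 1) x * T 2 x)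
          + ((0 * T 1 x + T 2 x * 2) * S' 2 x + S' (Suc 2) x * (2 * T 1 x))
          + ((T 1 x - 0) * S' 3 x + S' (Suc 3) x * (T 0 x - T\<^sub>c))) (at x)"
      by (rule DERIV_add DERIV_mult DERIV_diff DERIV_const dS dT0 dT1 dT2 that subsetD[OF UX])+
    moreover have "Suc 3 = 4" "Suc 2 = 3" "Suc (Suc 0) = 2" by simp_all
    ultimately show ?thesis
      using deriv_on[OF that F3, of "T 3 x * S' 1 x + 3 * T 2 x * S' 2 x + 3 * T 1 x * S' 3 x
      + (T 0 x - T\<^sub>c) * S' 4 x"]
      by (simp add: algebra_simps del: funpow.simps)
  qed
  have T00: "T 0 x\<^sub>c = T\<^sub>c" using c by (simp add: T_def)
  show "deriv (F_gen M S T\<^sub>c) x\<^sub>c = 0" "(deriv ^^ 2) (F_gen M S T\<^sub>c) x\<^sub>c = 0"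
    "(deriv ^^ 3) (F_gen M S T\<^sub>c) x\<^sub>c = 0"
    "(deriv ^^ 4) (F_gen M S T\<^sub>c) x\<^sub>c = (deriv ^^ 3) T\<^sub>H x\<^sub>c * deriv S x\<^sub>c"
    using F1[OF cU] F2[OF cU] F3[OF cU] F4[OF cU] c T00
    unfolding F_def[symmetric] S1 by (simp_all add: T_def)
qed

section \<open>Derivatives and Taylor expansion of the \<open>g\<close>-independent
  potential\<close>

text \<open>The parameter enters only as an overall factor \<open>1 / g\<close>. This lets the
  vanishing derivatives found for one value of \<open>g\<close> pass to the
  \<open>g\<close>-independent functions \<open>m\<close> and \<open>s\<close>.\<close>

lemma F_gen_iterated_deriv:
  assumes X: "open X" and m: "smooth_fun_on X m" and s: "smooth_fun_on X s" and x: "x \<in> X"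
  shows "(deriv ^^ n) (F_gen (\<lambda>x. m x / g) (\<lambda>x. s x / g) T) x
    = ((deriv ^^ n) m x - T * (deriv ^^ n) s x) / g"
  using x
proof (induction n arbitrary: x)
  case 0
  show ?case by (simp add: F_gen_def diff_divide_distrib)
next
  case (Suc n)
  have "((\<lambda>x. ((deriv ^^ n) m x - T * (deriv ^^ n) s x) / g) has_real_derivative
      ((deriv ^^ Suc n) m x - T * (deriv ^^ Suc n) s x) / g) (at x)"
    by (intro DERIV_cdivide DERIV_diff DERIV_cmult smooth_fun_on_has_derivative[OF m X Suc.prems]
        smooth_fun_on_has_derivative[OF s X Suc.prems])
  hence "((deriv ^^ n) (F_gen (\<lambda>x. m x / g) (\<lambda>x. s x / g) T) has_real_derivative
      ((deriv ^^ Suc n) m x - T * (deriv ^^ Suc n) s x) / g) (at x)"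
    by (rule has_field_derivative_transform_within_open[OF _ X Suc.prems]) (simp add: Suc.IH)
  thus ?case by (simp add: DERIV_imp_deriv)
qed

text \<open>Taylor's formula with a sixth-order remainder, where \<open>f n\<close> plays the role
  of the \<open>n\<close>-th derivative. The orders one to three drop out, and the sixth derivative
  is bounded on a compact ball. The fifth-order coefficient is kept explicit because its
  contribution will cancel by oddness; bounding it crudely would cost one order in the final
  error.\<close>

lemma quartic_expansion:
  fixes f :: "nat \<Rightarrow> real \<Rightarrow> real"
  assumes X: "open X" "c \<in> X"
    and f: "\<And>n x. x \<in> X \<Longrightarrow> (f n has_real_derivative f (Suc n) x) (at x)"
    and crit: "f 1 c = 0" "f 2 c = 0" "f 3 c = 0"
  obtains r E where "r > 0" "E \<ge> 0" "\<And>x. \<bar>x - c\<bar> \<le> r \<Longrightarrow> \<exists>q. f 0 x - f 0 c = (x - c) ^ 4 * q \<and>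
      \<bar>q - (f 4 c / 24 + f 5 c / 120 * (x - c))\<bar> \<le> E * (x - c)\<^sup>2"
proof -
  obtain r where r: "r > 0" "cball c r \<subseteq> X" using X open_contains_cball by blast
  have "continuous_on (cball c r) (f 6)"
    by (rule DERIV_continuous_on[OF has_field_derivative_at_within[OF f]]) (use r in blast)
  hence "bounded (f 6 ` cball c r)"
    by (intro compact_imp_bounded compact_continuous_image) auto
  then obtain B where B: "\<And>x. x \<in> cball c r \<Longrightarrow> \<bar>f 6 x\<bar> \<le> B"
    unfolding bounded_iff by (metis image_eqI real_norm_def)
  have B0: "B \<ge> 0" using B[of c] r by auto
  show thesis
  proof (rule that[of r "B / 720"])
    fix x assume x: "\<bar>x - c\<bar> \<le> r"
    show "\<exists>q. f 0 x - f 0 c = (x - c) ^ 4 * q \<and>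
      \<bar>q - (f 4 c / 24 + f 5 c / 120 * (x - c))\<bar> \<le> B / 720 * (x - c)\<^sup>2"
    proof (cases "x = c")
      case True
      \<comment> \<open>Here the equation leaves \<open>q\<close> free, but the error bound has
        right-hand side 0 and forces this witness.\<close>
      thus ?thesis by (intro exI[of _ "f 4 c / 24"]) simp
    next
      case False
      have "\<forall>m t. m < 6 \<and> c - r \<le> t \<and> t \<le> c + r \<longrightarrow> (f m has_real_derivative f (Suc m) t) (at t)"
        using r(2) by (auto intro!: f simp: dist_real_def subset_iff)
      from Taylor[OF _ refl this, of c x] False x r(1) obtain t where
        t: "if x < c then x < t \<and> t < c else c < t \<and> t < x"
        "f 0 x = (\<Sum>m<6. f m c / fact m * (x - c) ^ m) + f 6 t / fact 6 * (x - c) ^ 6"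
        by (auto simp: abs_le_iff)
      have sum_eq: "(\<Sum>m<6. f m c / fact m * y ^ m) = f 0 c + f 1 c * y + f 2 c / 2 * y ^ 2
          + f 3 c / 6 * y ^ 3 + f 4 c / 24 * y ^ 4 + f 5 c / 120 * y ^ 5" for y
        by (simp add: eval_nat_numeral)
      have "f 0 x - f 0 c = (x - c) ^ 4 * (f 4 c / 24 + f 5 c / 120 * (x - c) + f 6 t / 720 * (x - c)\<^sup>2)"
      proof -
        define y where "y = x - c"
        have "f 0 x - f 0 c = f 4 c / 24 * y ^ 4 + f 5 c / 120 * y ^ 5 + f 6 t / 720 * y ^ 6"
          unfolding t(2) sum_eq using crit by (simp add: fact_numeral y_def)
        also have "\<dots> = y ^ 4 * (f 4 c / 24 + f 5 c / 120 * y + f 6 t / 720 * y\<^sup>2)"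
          by (simp add: eval_nat_numeral algebra_simps)
        finally show ?thesis by (simp add: y_def)
      qed
      moreover have "\<bar>f 6 t / 720\<bar> * (x - c)\<^sup>2 \<le> B / 720 * (x - c)\<^sup>2"
        using B[of t] t(1) x by (intro mult_right_mono) (auto simp: dist_real_def split: if_splits)
      ultimately show ?thesis
        by (intro exI[of _ "f 4 c / 24 + f 5 c / 120 * (x - c) + f 6 t / 720 * (x - c)\<^sup>2"])
          (auto simp: abs_mult)
    qed
  qed (use r B0 in auto)
qed

section \<open>Laplace asymptotics at a quartic minimum\<close>

text \<open>A power of \<open>t\<close> is paid for with half of the decay rate: a single term of
  the exponential series gives \<open>(b * t) ^ n / fact n \<le> exp (b * t)\<close>.\<close>

lemma power_mult_exp_bound:
  fixes b :: real
  assumes "b > 0"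
  obtains K where "K \<ge> 0" "\<And>t. t \<ge> 0 \<Longrightarrow> t ^ n * exp (- (2 * b * t)) \<le> K * exp (- (b * t))"
proof
  let ?K = "fact n / b ^ n"
  show "?K \<ge> 0" using assms by simp
  fix t :: real assume t: "t \<ge> 0"
  have "(b * t) ^ n / fact n \<le> exp (b * t)"
  proof -
    have "(b * t) ^ n / fact n = (\<Sum>k\<in>{n}. (b * t) ^ k / fact k)" by simp
    also have "\<dots> \<le> (\<Sum>k. (b * t) ^ k / fact k)"
      using summable_exp[of "b * t"] assms t
      by (intro sum_le_suminf) (auto simp: divide_inverse mult.commute)
    also have "\<dots> = exp (b * t)" by (simp add: exp_def divide_inverse mult.commute)
    finally show ?thesis .
  qed
  hence "t ^ n \<le> ?K * exp (b * t)"
    using assms by (simp add: power_mult_distrib field_simps)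
  hence "t ^ n * exp (- (2 * b * t)) \<le> ?K * exp (b * t) * exp (- (2 * b * t))"
    by (rule mult_right_mono) simp
  also have "\<dots> = ?K * exp (- (b * t))"
    by (simp add: mult_exp_exp mult.assoc)
  finally show "t ^ n * exp (- (2 * b * t)) \<le> ?K * exp (- (b * t))" .
qed

text \<open>Each derivative of \<open>h (t * q)\<close> in \<open>q\<close> brings down a factor
  \<open>t\<close>, which is unbounded. Since \<open>q \<ge> \<alpha> / 2\<close>, the weight decays
  like \<open>exp (- (\<alpha> / 4 * t))\<close>; giving up half of this rate absorbs up to two
  factors of \<open>t\<close>. The first- and second-order Taylor bounds in \<open>q\<close> thereby
  become uniform in \<open>t\<close>.\<close>

lemma taylor_argument_scaling:
  fixes h h' h'' :: "real \<Rightarrow> real" and \<alpha> :: real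
  assumes h: "\<And>s. (h has_real_derivative h' s) (at s)"
    and h': "\<And>s. (h' has_real_derivative h'' s) (at s)"
    and bound: "\<And>s. s \<ge> 0 \<Longrightarrow> \<bar>h s\<bar> \<le> K * exp (- s / 2)"
      "\<And>s. s \<ge> 0 \<Longrightarrow> \<bar>h' s\<bar> \<le> K * exp (- s / 2)"
      "\<And>s. s \<ge> 0 \<Longrightarrow> \<bar>h'' s\<bar> \<le> K * exp (- s / 2)"
    and \<alpha>: "\<alpha> > 0"
  obtains L where "L \<ge> 0"
    "\<And>t q. t \<ge> 0 \<Longrightarrow> \<bar>q - \<alpha>\<bar> \<le> \<alpha> / 2 \<Longrightarrow> \<bar>h (t * q)\<bar> \<le> L * exp (- (\<alpha> / 8 * t))"
    "\<And>t q. t \<ge> 0 \<Longrightarrow> \<bar>q - \<alpha>\<bar> \<le> \<alpha> / 2 \<Longrightarrow> \<bar>t * h' (t * q)\<bar> \<le> L * exp (- (\<alpha> / 8 * t))"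
    "\<And>t q. t \<ge> 0 \<Longrightarrow> \<bar>q - \<alpha>\<bar> \<le> \<alpha> / 2 \<Longrightarrow>
       \<bar>h (t * q) - h (t * \<alpha>)\<bar> \<le> L * exp (- (\<alpha> / 8 * t)) * \<bar>q - \<alpha>\<bar>"
    "\<And>t q. t \<ge> 0 \<Longrightarrow> \<bar>q - \<alpha>\<bar> \<le> \<alpha> / 2 \<Longrightarrow>
       \<bar>h (t * q) - h (t * \<alpha>) - t * h' (t * \<alpha>) * (q - \<alpha>)\<bar>
         \<le> L * exp (- (\<alpha> / 8 * t)) * (q - \<alpha>)\<^sup>2"
proof -
  have K: "K \<ge> 0" using bound(1)[of 0] by simp
  obtain K0 where K0: "K0 \<ge> 0" "\<And>t. t \<ge> 0 \<Longrightarrow> t ^ 0 * exp (- (2 * (\<alpha>/8) * t)) \<le> K0 * exp (- (\<alpha>/8 * t))"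
    using power_mult_exp_bound[of "\<alpha>/8" 0] \<alpha> by auto
  obtain K1 where K1: "K1 \<ge> 0" "\<And>t. t \<ge> 0 \<Longrightarrow> t ^ 1 * exp (- (2 * (\<alpha>/8) * t)) \<le> K1 * exp (- (\<alpha>/8 * t))"
    using power_mult_exp_bound[of "\<alpha>/8" 1] \<alpha> by auto
  obtain K2 where K2: "K2 \<ge> 0" "\<And>t. t \<ge> 0 \<Longrightarrow> t ^ 2 * exp (- (2 * (\<alpha>/8) * t)) \<le> K2 * exp (- (\<alpha>/8 * t))"
    using power_mult_exp_bound[of "\<alpha>/8" 2] \<alpha> by auto
  define L where "L = K * (K0 + K1 + K2)"
  have L: "L \<ge> 0" using K K0(1) K1(1) K2(1) by (simp add: L_def)
  \<comment> \<open>One estimate serves all cases: \<open>f\<close> is \<open>h\<close>,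
    \<open>h'\<close> or \<open>h''\<close>, and \<open>j\<close> is the number of factors
    \<open>t\<close> that come with it.\<close>
  have gen: "\<bar>t ^ j * f (t * q)\<bar> \<le> L * exp (- (\<alpha> / 8 * t))"
    if t: "t \<ge> 0" and q: "\<bar>q - \<alpha>\<bar> \<le> \<alpha> / 2" and j: "j \<in> {0, 1, 2}"
      and f: "\<And>s. s \<ge> 0 \<Longrightarrow> \<bar>f s\<bar> \<le> K * exp (- s / 2)" for f :: "real \<Rightarrow> real" and t q j
  proof -
    have q2: "q \<ge> \<alpha> / 2" using q unfolding abs_le_iff by linarith
    have tq: "t * q \<ge> t * (\<alpha> / 2)" using t q2 by (rule mult_left_mono[rotated])
    moreover have "t * (\<alpha> / 2) \<ge> 0" using t \<alpha> by simp
    ultimately have tq0: "t * q \<ge> 0" by linarith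
    have "\<bar>f (t * q)\<bar> \<le> K * exp (- (t * q) / 2)" by (rule f[OF tq0])
    also have "\<dots> \<le> K * exp (- (2 * (\<alpha>/8) * t))"
      using K tq by (intro mult_left_mono) (auto simp: algebra_simps)
    finally have "t ^ j * \<bar>f (t * q)\<bar> \<le> t ^ j * (K * exp (- (2 * (\<alpha>/8) * t)))"
      using t by (intro mult_left_mono) auto
    also have "\<dots> = K * (t ^ j * exp (- (2 * (\<alpha>/8) * t)))" by simp
    also have "\<dots> \<le> K * ((K0 + K1 + K2) * exp (- (\<alpha>/8 * t)))"
    proof (rule mult_left_mono[OF _ K])
      have "t ^ j * exp (- (2 * (\<alpha>/8) * t)) \<le> (if j = 0 then K0 else if j = 1 then K1 else K2) * exp (- (\<alpha>/8 * t))"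
        using j K0(2)[OF t] K1(2)[OF t] K2(2)[OF t] by auto
      also have "\<dots> \<le> (K0 + K1 + K2) * exp (- (\<alpha>/8 * t))"
        using K0(1) K1(1) K2(1) by (intro mult_right_mono) auto
      finally show "t ^ j * exp (- (2 * (\<alpha>/8) * t)) \<le> (K0 + K1 + K2) * exp (- (\<alpha>/8 * t))" .
    qed
    finally show ?thesis using t by (simp add: L_def abs_mult mult.assoc)
  qed
  have mvt: "\<bar>F q - F \<alpha>\<bar> \<le> B * \<bar>q - \<alpha>\<bar>"
    if "\<bar>q - \<alpha>\<bar> \<le> d" and F: "\<And>p. (F has_real_derivative F' p) (at p)"
      and "\<And>p. \<bar>p - \<alpha>\<bar> \<le> d \<Longrightarrow> \<bar>F' p\<bar> \<le> B" for F F' :: "real \<Rightarrow> real" and q B d :: real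
  proof -
    have "norm (F q - F \<alpha>) \<le> B * norm (q - \<alpha>)"
      by (rule field_differentiable_bound[where S = "cball \<alpha> d" and f' = F'])
        (use that in \<open>auto simp: dist_real_def abs_minus_commute intro: has_field_derivative_at_within zero_le_dist order_trans[OF abs_ge_zero]\<close>)
    thus ?thesis by simp
  qed
  show thesis
  proof (rule that[OF L])
    fix t q :: real assume t: "t \<ge> 0" and q: "\<bar>q - \<alpha>\<bar> \<le> \<alpha> / 2"
    let ?E = "L * exp (- (\<alpha> / 8 * t))"
    show "\<bar>h (t * q)\<bar> \<le> ?E" using gen[OF t q, of 0 h] bound by simp
    show "\<bar>t * h' (t * q)\<bar> \<le> ?E" using gen[OF t q, of 1 h'] bound by simp
    have dh: "((\<lambda>p. h (t * p)) has_real_derivative t * h' (t * p)) (at p)" for p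
      by (rule DERIV_cong[OF DERIV_chain'[OF DERIV_cmult_Id h]]) simp
    have dh1: "((\<lambda>p. t * h' (t * p)) has_real_derivative t\<^sup>2 * h'' (t * p)) (at p)" for p
      by (rule DERIV_cong[OF DERIV_cmult[OF DERIV_chain'[OF DERIV_cmult_Id h']]])
        (simp add: power2_eq_square)
    show "\<bar>h (t * q) - h (t * \<alpha>)\<bar> \<le> ?E * \<bar>q - \<alpha>\<bar>"
    proof (rule mvt[OF q dh])
      fix p assume p: "\<bar>p - \<alpha>\<bar> \<le> \<alpha> / 2"
      show "\<bar>t * h' (t * p)\<bar> \<le> ?E" using gen[OF t p, of 1 h'] bound by simp
    qed
    have inner: "\<bar>t * h' (t * p) - t * h' (t * \<alpha>)\<bar> \<le> ?E * \<bar>p - \<alpha>\<bar>" if p: "\<bar>p - \<alpha>\<bar> \<le> \<alpha> / 2" for p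
    proof (rule mvt[OF p dh1])
      fix p assume p: "\<bar>p - \<alpha>\<bar> \<le> \<alpha> / 2"
      show "\<bar>t\<^sup>2 * h'' (t * p)\<bar> \<le> ?E" using gen[OF t p, of 2 h''] bound by simp
    qed
    \<comment> \<open>The mean value inequality is applied to \<open>h (t * p)\<close> minus its
      tangent at \<alpha>. The derivative of this difference is controlled by \<open>inner\<close>,
      so on the ball of radius \<open>\<bar>q - \<alpha>\<bar>\<close> the bound becomes
      quadratic.\<close>
    have "\<bar>(h (t * q) - t * h' (t * \<alpha>) * (q - \<alpha>)) - (h (t * \<alpha>) - t * h' (t * \<alpha>) * (\<alpha> - \<alpha>))\<bar>
        \<le> (?E * \<bar>q - \<alpha>\<bar>) * \<bar>q - \<alpha>\<bar>"
    proof (rule mvt[where F = "\<lambda>p. h (t * p) - t * h' (t * \<alpha>) * (p - \<alpha>)" and d = "\<bar>q - \<alpha>\<bar>"])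
      show "((\<lambda>p. h (t * p) - t * h' (t * \<alpha>) * (p - \<alpha>)) has_real_derivative
          t * h' (t * p) - t * h' (t * \<alpha>)) (at p)" for p
        by (auto intro!: derivative_eq_intros dh)
      fix p assume p: "\<bar>p - \<alpha>\<bar> \<le> \<bar>q - \<alpha>\<bar>"
      have "\<bar>t * h' (t * p) - t * h' (t * \<alpha>)\<bar> \<le> ?E * \<bar>p - \<alpha>\<bar>"
        using p q by (intro inner) simp
      also have "\<dots> \<le> ?E * \<bar>q - \<alpha>\<bar>" using p L by (intro mult_left_mono) auto
      finally show "\<bar>t * h' (t * p) - t * h' (t * \<alpha>)\<bar> \<le> ?E * \<bar>q - \<alpha>\<bar>" .
    qed simp
    hence "\<bar>h (t * q) - h (t * \<alpha>) - t * h' (t * \<alpha>) * (q - \<alpha>)\<bar> \<le> (?E * \<bar>q - \<alpha>\<bar>) * \<bar>q - \<alpha>\<bar>"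
      by (simp add: algebra_simps)
    also have "\<dots> = ?E * (q - \<alpha>)\<^sup>2"
      by (simp add: power2_eq_square mult.assoc)
    finally show "\<bar>h (t * q) - h (t * \<alpha>) - t * h' (t * \<alpha>) * (q - \<alpha>)\<bar> \<le> ?E * (q - \<alpha>)\<^sup>2" .
  qed
qed

section \<open>Integrals over the whole line\<close>

text \<open>Completing the square in \<open>x\<^sup>2\<close> gives
  \<open>c * x ^ 4 \<ge> x\<^sup>2 / 2 - 1 / (16 * c)\<close>, so the integrand is dominated by a
  multiple of an absolute moment of the standard normal density.\<close>

lemma integrable_power_exp_quartic:
  fixes c :: real
  assumes "c > 0"
  shows "integrable lborel (\<lambda>x::real. \<bar>x\<bar> ^ k * exp (- (c * x ^ 4)))"
proof (rule Bochner_Integration.integrable_bound)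
  let ?C = "exp (1 / (16 * c)) * sqrt (2 * pi)"
  show "integrable lborel (\<lambda>x::real. ?C * (std_normal_density x * \<bar>x\<bar> ^ k))"
    by (intro integrable_mult_right integrable_std_normal_moment_abs)
  show "(\<lambda>x::real. \<bar>x\<bar> ^ k * exp (- (c * x ^ 4))) \<in> borel_measurable lborel" by simp
  show "AE x in lborel. norm (\<bar>x\<bar> ^ k * exp (- (c * x ^ 4))) \<le> norm (?C * (std_normal_density x * \<bar>x\<bar> ^ k))"
  proof (rule AE_I2)
    fix x :: real
    have "0 \<le> c * (x\<^sup>2 - 1 / (4 * c))\<^sup>2" using assms by simp
    also have "\<dots> = c * x ^ 4 - x\<^sup>2 / 2 + 1 / (16 * c)"
      using assms by (simp add: power2_eq_square power4_eq_xxxx field_simps)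
    finally have "exp (- (c * x ^ 4)) \<le> exp (1 / (16 * c)) * exp (- x\<^sup>2 / 2)"
      by (simp add: mult_exp_exp)
    hence "\<bar>x\<bar> ^ k * exp (- (c * x ^ 4)) \<le> \<bar>x\<bar> ^ k * (exp (1 / (16 * c)) * exp (- x\<^sup>2 / 2))"
      by (intro mult_left_mono) auto
    also have "\<dots> = ?C * (std_normal_density x * \<bar>x\<bar> ^ k)"
      by (simp add: std_normal_density_def)
    finally show "norm (\<bar>x\<bar> ^ k * exp (- (c * x ^ 4))) \<le> norm (?C * (std_normal_density x * \<bar>x\<bar> ^ k))"
      by simp
  qed
qed

lemma integral_scaled:
  fixes f :: "real \<Rightarrow> real"
  assumes "w > 0"
  shows "(\<integral>x. f ((x - a) / w) \<partial>lborel) = w * (\<integral>y. f y \<partial>lborel)"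
  using assms lborel_integral_real_affine[of w "\<lambda>x. f ((x - a) / w)" a] by simp

lemma integrable_scaled:
  fixes f :: "real \<Rightarrow> real"
  assumes "w > 0" "integrable lborel f"
  shows "integrable lborel (\<lambda>x. f ((x - a) / w))"
  using assms lborel_integrable_real_affine[of f "1 / w" "- a / w"]
  by (simp add: diff_divide_distrib)

lemma integral_odd_about:
  fixes f :: "real \<Rightarrow> real"
  assumes "\<And>x. f (2 * a - x) = - f x"
  shows "(\<integral>x. f x \<partial>lborel) = 0"
  using lborel_integral_real_affine[of "-1" f "2 * a"] assms by simp

text \<open>Here \<open>w\<close> is the length scale, \<open>p\<close> the density and
  \<open>u\<close> the reduced action in units of \<open>g\<close>. The constant \<open>B\<close> is
  chosen before \<open>w\<close>, \<open>p\<close> and \<open>u\<close>, so the error is uniform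
  over a density that itself varies with \<open>g\<close>. Inside the window the integrand is
  replaced by an even and an odd model that are integrated over the whole line; the difference is
  dominated by a scaled second moment, which is of order \<open>w ^ 3\<close>.\<close>

lemma quartic_laplace:
  fixes h h' h'' :: "real \<Rightarrow> real" and a r \<alpha> \<beta> k l C E :: real
  assumes h: "\<And>s. (h has_real_derivative h' s) (at s)"
    and h': "\<And>s. (h' has_real_derivative h'' s) (at s)"
    and bound: "\<And>s. s \<ge> 0 \<Longrightarrow> \<bar>h s\<bar> \<le> K * exp (- s / 2)"
      "\<And>s. s \<ge> 0 \<Longrightarrow> \<bar>h' s\<bar> \<le> K * exp (- s / 2)"
      "\<And>s. s \<ge> 0 \<Longrightarrow> \<bar>h'' s\<bar> \<le> K * exp (- s / 2)"
    and \<alpha>: "\<alpha> > 0" and r: "0 < r" "r \<le> 1" and C: "C \<ge> 0" and E: "E \<ge> 0"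
  shows "\<exists>B. \<forall>w p u. w > 0 \<longrightarrow>
      set_borel_measurable lebesgue {x. \<bar>x - a\<bar> < r} p \<longrightarrow>
      set_borel_measurable lebesgue {x. \<bar>x - a\<bar> < r} u \<longrightarrow>
      (\<forall>x. \<bar>x - a\<bar> < r \<longrightarrow> \<bar>p x - (k + l * (x - a))\<bar> \<le> C * (x - a)\<^sup>2) \<longrightarrow>
      (\<forall>x. \<bar>x - a\<bar> < r \<longrightarrow> (\<exists>q. u x = ((x - a) / w) ^ 4 * q \<and>
         \<bar>q - (\<alpha> + \<beta> * (x - a))\<bar> \<le> E * (x - a)\<^sup>2 \<and> \<bar>q - \<alpha>\<bar> \<le> \<alpha> / 2)) \<longrightarrow>
      set_integrable lebesgue {x. \<bar>x - a\<bar> < r} (\<lambda>x. p x * h (u x)) \<and>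
      \<bar>(LINT x:{x. \<bar>x - a\<bar> < r}|lebesgue. p x * h (u x))
         - k * w * (\<integral>y. h (\<alpha> * y ^ 4) \<partial>lborel)\<bar> \<le> B * w ^ 3"
proof -
  obtain L where L: "L \<ge> 0"
    and Lh: "\<And>t q. t \<ge> 0 \<Longrightarrow> \<bar>q - \<alpha>\<bar> \<le> \<alpha> / 2 \<Longrightarrow> \<bar>h (t * q)\<bar> \<le> L * exp (- (\<alpha> / 8 * t))"
    and Lh1: "\<And>t q. t \<ge> 0 \<Longrightarrow> \<bar>q - \<alpha>\<bar> \<le> \<alpha> / 2 \<Longrightarrow> \<bar>t * h' (t * q)\<bar> \<le> L * exp (- (\<alpha> / 8 * t))"
    and Ld: "\<And>t q. t \<ge> 0 \<Longrightarrow> \<bar>q - \<alpha>\<bar> \<le> \<alpha> / 2 \<Longrightarrow>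
       \<bar>h (t * q) - h (t * \<alpha>)\<bar> \<le> L * exp (- (\<alpha> / 8 * t)) * \<bar>q - \<alpha>\<bar>"
    and Ldd: "\<And>t q. t \<ge> 0 \<Longrightarrow> \<bar>q - \<alpha>\<bar> \<le> \<alpha> / 2 \<Longrightarrow>
       \<bar>h (t * q) - h (t * \<alpha>) - t * h' (t * \<alpha>) * (q - \<alpha>)\<bar>
         \<le> L * exp (- (\<alpha> / 8 * t)) * (q - \<alpha>)\<^sup>2"
    by (rule taylor_argument_scaling[OF h h' bound \<alpha>]) (auto)
  \<comment> \<open>\<open>b\<close> bounds \<open>\<bar>q - \<alpha>\<bar>\<close> by a multiple of
    the distance from the centre, \<open>P\<close> collects the error constants inside the window
    and \<open>Q\<close> those outside it, and \<open>J\<close> is the second moment at scale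
    1.\<close>
  define b where "b = \<bar>\<beta>\<bar> + E"
  define P where "P = C * L + \<bar>l\<bar> * (L * b) + \<bar>k\<bar> * (L * b\<^sup>2) + \<bar>k\<bar> * (L * E)"
  define Q where "Q = L * (\<bar>k\<bar> / r\<^sup>2 + \<bar>l\<bar> / r + \<bar>k\<bar> * \<bar>\<beta>\<bar> / r)"
  define J where "J = (\<integral>y. \<bar>y\<bar> ^ 2 * exp (- (\<alpha> / 8 * y ^ 4)) \<partial>lborel)"
  have b: "b \<ge> 0" using E by (simp add: b_def)
  have P: "P \<ge> 0" using C L b E by (simp add: P_def)
  have Q: "Q \<ge> 0" using L r by (simp add: Q_def)
  have cont_h: "continuous_on UNIV h" "continuous_on UNIV h'"
    by (rule DERIV_continuous_on[OF has_field_derivative_at_within[OF h]])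
      (rule DERIV_continuous_on[OF has_field_derivative_at_within[OF h']])
  have meas[measurable]: "h \<in> borel_measurable borel" "h' \<in> borel_measurable borel"
    using cont_h by (auto intro: borel_measurable_continuous_onI)
  \<comment> \<open>Four errors of second order in \<delta> add up to \<open>P\<close>: the density
    remainder, the linear density term times the first-order change of \<open>h\<close>, the Taylor
    remainder of \<open>h\<close>, and the replacement of \<open>q - \<alpha>\<close> by
    \<open>\<beta> * \<delta>\<close>.\<close>
  have near: "\<bar>p * h (t * q) - ((k + l * \<delta>) * h (t * \<alpha>) + k * \<beta> * \<delta> * (t * h' (t * \<alpha>)))\<bar>
      \<le> P * (\<delta>\<^sup>2 * exp (- (\<alpha> / 8 * t)))"
    if t: "t \<ge> 0" and \<delta>: "\<bar>\<delta>\<bar> \<le> 1" and p: "\<bar>p - (k + l * \<delta>)\<bar> \<le> C * \<delta>\<^sup>2"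
      and q: "\<bar>q - (\<alpha> + \<beta> * \<delta>)\<bar> \<le> E * \<delta>\<^sup>2" "\<bar>q - \<alpha>\<bar> \<le> \<alpha> / 2" for t \<delta> p q
  proof -
    let ?e = "exp (- (\<alpha> / 8 * t))"
    have "\<delta>\<^sup>2 \<le> \<bar>\<delta>\<bar>"
      using mult_left_mono[OF \<delta>, of "\<bar>\<delta>\<bar>"] by (simp add: power2_eq_square)
    hence "E * \<delta>\<^sup>2 \<le> E * \<bar>\<delta>\<bar>" using E by (rule mult_left_mono)
    hence "\<bar>q - \<alpha>\<bar> \<le> b * \<bar>\<delta>\<bar>"
      using q(1) abs_triangle_ineq[of "q - (\<alpha> + \<beta> * \<delta>)" "\<beta> * \<delta>"]
      by (simp add: b_def algebra_simps abs_mult)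
    moreover from this have "\<bar>q - \<alpha>\<bar> ^ 2 \<le> (b * \<bar>\<delta>\<bar>) ^ 2" by (rule power_mono) simp
    hence "(q - \<alpha>)\<^sup>2 \<le> b\<^sup>2 * \<delta>\<^sup>2" by (simp add: power_mult_distrib)
    ultimately have d1: "\<bar>q - \<alpha>\<bar> \<le> b * \<bar>\<delta>\<bar>" and d2: "(q - \<alpha>)\<^sup>2 \<le> b\<^sup>2 * \<delta>\<^sup>2" by auto
    have sq: "\<delta>\<^sup>2 = \<bar>\<delta>\<bar> * \<bar>\<delta>\<bar>" by (simp add: power2_eq_square)
    have e1: "\<bar>(p - (k + l * \<delta>)) * h (t * q)\<bar> \<le> (C * \<delta>\<^sup>2) * (L * ?e)"
      unfolding abs_mult using p Lh[OF t q(2)] C by (intro mult_mono) auto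
    have "\<bar>h (t * q) - h (t * \<alpha>)\<bar> \<le> L * ?e * (b * \<bar>\<delta>\<bar>)"
      using Ld[OF t q(2)] by (rule order_trans) (use d1 L in \<open>intro mult_left_mono, auto\<close>)
    hence "\<bar>l * \<delta>\<bar> * \<bar>h (t * q) - h (t * \<alpha>)\<bar> \<le> \<bar>l * \<delta>\<bar> * (L * ?e * (b * \<bar>\<delta>\<bar>))"
      by (rule mult_left_mono) simp
    hence e2: "\<bar>l * \<delta> * (h (t * q) - h (t * \<alpha>))\<bar> \<le> \<bar>l\<bar> * (L * b) * (\<delta>\<^sup>2 * ?e)"
      unfolding abs_mult sq by (simp only: mult_ac)
    have "\<bar>h (t * q) - h (t * \<alpha>) - t * h' (t * \<alpha>) * (q - \<alpha>)\<bar> \<le> L * ?e * (b\<^sup>2 * \<delta>\<^sup>2)"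
      using Ldd[OF t q(2)] by (rule order_trans) (use d2 L in \<open>intro mult_left_mono, auto\<close>)
    hence "\<bar>k\<bar> * \<bar>h (t * q) - h (t * \<alpha>) - t * h' (t * \<alpha>) * (q - \<alpha>)\<bar>
        \<le> \<bar>k\<bar> * (L * ?e * (b\<^sup>2 * \<delta>\<^sup>2))"
      by (rule mult_left_mono) simp
    hence e3: "\<bar>k * (h (t * q) - h (t * \<alpha>) - t * h' (t * \<alpha>) * (q - \<alpha>))\<bar>
        \<le> \<bar>k\<bar> * (L * b\<^sup>2) * (\<delta>\<^sup>2 * ?e)"
      by (simp add: abs_mult mult_ac)
    have "\<bar>t * h' (t * \<alpha>)\<bar> * \<bar>q - (\<alpha> + \<beta> * \<delta>)\<bar> \<le> (L * ?e) * (E * \<delta>\<^sup>2)"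
      using Lh1[OF t, of \<alpha>] q(1) \<alpha> L by (intro mult_mono) auto
    hence "\<bar>k\<bar> * (\<bar>t * h' (t * \<alpha>)\<bar> * \<bar>q - (\<alpha> + \<beta> * \<delta>)\<bar>) \<le> \<bar>k\<bar> * ((L * ?e) * (E * \<delta>\<^sup>2))"
      by (rule mult_left_mono) simp
    hence e4: "\<bar>k * (t * h' (t * \<alpha>) * (q - (\<alpha> + \<beta> * \<delta>)))\<bar> \<le> \<bar>k\<bar> * (L * E) * (\<delta>\<^sup>2 * ?e)"
      by (simp add: abs_mult mult_ac)
    have "p * h (t * q) - ((k + l * \<delta>) * h (t * \<alpha>) + k * \<beta> * \<delta> * (t * h' (t * \<alpha>)))
      = (p - (k + l * \<delta>)) * h (t * q) + l * \<delta> * (h (t * q) - h (t * \<alpha>))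
        + k * (h (t * q) - h (t * \<alpha>) - t * h' (t * \<alpha>) * (q - \<alpha>))
        + k * (t * h' (t * \<alpha>) * (q - (\<alpha> + \<beta> * \<delta>)))"
      by (simp add: algebra_simps)
    moreover have "P * (\<delta>\<^sup>2 * ?e) = (C * \<delta>\<^sup>2) * (L * ?e) + \<bar>l\<bar> * (L * b) * (\<delta>\<^sup>2 * ?e)
        + \<bar>k\<bar> * (L * b\<^sup>2) * (\<delta>\<^sup>2 * ?e) + \<bar>k\<bar> * (L * E) * (\<delta>\<^sup>2 * ?e)"
      by (simp add: P_def algebra_simps)
    ultimately show ?thesis using e1 e2 e3 e4 by linarith
  qed
  \<comment> \<open>The models do not stop at the edge of the window. Beyond it
    \<open>1 \<le> \<delta>\<^sup>2 / r\<^sup>2\<close> and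
    \<open>\<bar>\<delta>\<bar> \<le> \<delta>\<^sup>2 / r\<close>, so their excess obeys a bound of
    the same shape as the error inside.\<close>
  have far: "\<bar>(k + l * \<delta>) * h (t * \<alpha>) + k * \<beta> * \<delta> * (t * h' (t * \<alpha>))\<bar>
      \<le> Q * (\<delta>\<^sup>2 * exp (- (\<alpha> / 8 * t)))" if t: "t \<ge> 0" and \<delta>: "\<bar>\<delta>\<bar> \<ge> r" for t \<delta>
  proof -
    let ?e = "exp (- (\<alpha> / 8 * t))"
    have "\<bar>\<delta>\<bar> * r \<le> \<bar>\<delta>\<bar> * \<bar>\<delta>\<bar>" using \<delta> by (rule mult_left_mono) simp
    hence d1: "\<bar>\<delta>\<bar> \<le> \<delta>\<^sup>2 / r" using r by (simp add: field_simps power2_eq_square)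
    have "r ^ 2 \<le> \<bar>\<delta>\<bar> ^ 2" using \<delta> r by (intro power_mono) auto
    hence d0: "1 \<le> \<delta>\<^sup>2 / r\<^sup>2" using r by (simp add: field_simps)
    have H: "\<bar>h (t * \<alpha>)\<bar> \<le> L * ?e" "\<bar>t * h' (t * \<alpha>)\<bar> \<le> L * ?e"
      using Lh[OF t, of \<alpha>] Lh1[OF t, of \<alpha>] \<alpha> by auto
    have "\<bar>k\<bar> * 1 \<le> \<bar>k\<bar> * (\<delta>\<^sup>2 / r\<^sup>2)" by (intro mult_left_mono d0) auto
    moreover have "\<bar>l\<bar> * \<bar>\<delta>\<bar> \<le> \<bar>l\<bar> * (\<delta>\<^sup>2 / r)" by (intro mult_left_mono d1) auto
    moreover have "\<bar>k + l * \<delta>\<bar> \<le> \<bar>k\<bar> + \<bar>l\<bar> * \<bar>\<delta>\<bar>"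
      using abs_triangle_ineq[of k "l * \<delta>"] by (simp add: abs_mult)
    ultimately have c1: "\<bar>k + l * \<delta>\<bar> \<le> \<bar>k\<bar> * (\<delta>\<^sup>2 / r\<^sup>2) + \<bar>l\<bar> * (\<delta>\<^sup>2 / r)" by linarith
    have e1: "\<bar>(k + l * \<delta>) * h (t * \<alpha>)\<bar> \<le> (\<bar>k\<bar> * (\<delta>\<^sup>2 / r\<^sup>2) + \<bar>l\<bar> * (\<delta>\<^sup>2 / r)) * (L * ?e)"
      unfolding abs_mult using c1 H(1) by (intro mult_mono) auto
    have "\<bar>k * \<beta>\<bar> * \<bar>\<delta>\<bar> \<le> \<bar>k * \<beta>\<bar> * (\<delta>\<^sup>2 / r)" by (intro mult_left_mono d1) auto
    hence c2: "\<bar>k * \<beta> * \<delta>\<bar> \<le> \<bar>k\<bar> * \<bar>\<beta>\<bar> * (\<delta>\<^sup>2 / r)" by (simp add: abs_mult)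
    have e2: "\<bar>k * \<beta> * \<delta> * (t * h' (t * \<alpha>))\<bar> \<le> (\<bar>k\<bar> * \<bar>\<beta>\<bar> * (\<delta>\<^sup>2 / r)) * (L * ?e)"
      using mult_mono[OF c2 H(2)] r by (simp add: abs_mult)
    have "Q * (\<delta>\<^sup>2 * ?e) = (\<bar>k\<bar> * (\<delta>\<^sup>2 / r\<^sup>2) + \<bar>l\<bar> * (\<delta>\<^sup>2 / r)) * (L * ?e)
       + (\<bar>k\<bar> * \<bar>\<beta>\<bar> * (\<delta>\<^sup>2 / r)) * (L * ?e)"
      by (simp add: Q_def algebra_simps)
    thus ?thesis using e1 e2 by linarith
  qed
  show ?thesis
  proof (intro exI[of _ "(P + Q) * J"] allI impI, goal_cases)
    case (1 w \<rho> u)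
    note w = 1(1) and \<rho>m = 1(2) and um = 1(3) and \<rho> = 1(4)[rule_format] and u = 1(5)[rule_format]
    \<comment> \<open>\<open>G\<close> is the true integrand extended by 0,
      \<open>even + odd\<close> its model on the whole line, and \<open>D\<close> the majorant of
      the difference that \<open>near\<close> and \<open>far\<close> provide.\<close>
    define t where "t x = ((x - a) / w) ^ 4" for x
    define even where "even x = k * h (\<alpha> * t x)" for x
    define odd where "odd x = (x - a) * (l * h (\<alpha> * t x) + k * \<beta> * (t x * h' (\<alpha> * t x)))" for x
    define D where "D x = (P + Q) * ((x - a)\<^sup>2 * exp (- (\<alpha> / 8 * t x)))" for x
    define G where "G x = indicator {x. \<bar>x - a\<bar> < r} x *\<^sub>R (\<rho> x * h (u x))" for x
    have t0: "t x \<ge> 0" for x by (simp add: t_def)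
    have tm[measurable]: "t \<in> borel_measurable borel" unfolding t_def by measurable
    have mom: "integrable lborel (\<lambda>x. \<bar>(x - a) / w\<bar> ^ n * exp (- (\<alpha> / 8 * t x)))" for n
      unfolding t_def
      using integrable_scaled[OF w integrable_power_exp_quartic[of "\<alpha> / 8" n], of a] \<alpha> by simp
    have D_eq: "D x = (P + Q) * w\<^sup>2 * (\<bar>(x - a) / w\<bar> ^ 2 * exp (- (\<alpha> / 8 * t x)))" for x
      using w by (simp add: D_def power_divide)
    have D_int: "integrable lborel D"
      unfolding D_eq using mom[of 2] by (rule integrable_mult_right)
    have D_val: "(\<integral>x. D x \<partial>lborel) = (P + Q) * J * w ^ 3"
    proof -
      have "(\<integral>x. D x \<partial>lborel)
          = (P + Q) * w\<^sup>2 * (\<integral>x. \<bar>(x - a) / w\<bar> ^ 2 * exp (- (\<alpha> / 8 * t x)) \<partial>lborel)"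
        unfolding D_eq by (rule integral_mult_right_zero)
      also have "(\<integral>x. \<bar>(x - a) / w\<bar> ^ 2 * exp (- (\<alpha> / 8 * t x)) \<partial>lborel) = w * J"
        unfolding t_def J_def using integral_scaled[OF w] .
      finally show ?thesis by (simp add: power2_eq_square power3_eq_cube)
    qed
    have e_int: "integrable lborel even"
    proof (rule Bochner_Integration.integrable_bound)
      show "integrable lborel (\<lambda>x. \<bar>k\<bar> * L * (\<bar>(x - a) / w\<bar> ^ 0 * exp (- (\<alpha> / 8 * t x))))"
        using mom[of 0] by (rule integrable_mult_right)
      show "even \<in> borel_measurable lborel" unfolding even_def by measurable
      show "AE x in lborel. norm (even x)
          \<le> norm (\<bar>k\<bar> * L * (\<bar>(x - a) / w\<bar> ^ 0 * exp (- (\<alpha> / 8 * t x))))"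
      proof (rule AE_I2)
        fix x
        have "\<bar>h (\<alpha> * t x)\<bar> \<le> L * exp (- (\<alpha> / 8 * t x))"
          using Lh[OF t0[of x], of \<alpha>] \<alpha> by (simp add: mult.commute)
        hence "\<bar>k\<bar> * \<bar>h (\<alpha> * t x)\<bar> \<le> \<bar>k\<bar> * (L * exp (- (\<alpha> / 8 * t x)))"
          by (rule mult_left_mono) simp
        thus "norm (even x) \<le> norm (\<bar>k\<bar> * L * (\<bar>(x - a) / w\<bar> ^ 0 * exp (- (\<alpha> / 8 * t x))))"
          using L by (simp add: even_def abs_mult)
      qed
    qed
    have o_int: "integrable lborel odd"
    proof (rule Bochner_Integration.integrable_bound)
      show "integrable lborel (\<lambda>x. (\<bar>l\<bar> + \<bar>k * \<beta>\<bar>) * L * w * (\<bar>(x - a) / w\<bar> ^ 1 * exp (- (\<alpha> / 8 * t x))))"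
        using mom[of 1] by (rule integrable_mult_right)
      show "odd \<in> borel_measurable lborel" unfolding odd_def by measurable
      show "AE x in lborel. norm (odd x)
          \<le> norm ((\<bar>l\<bar> + \<bar>k * \<beta>\<bar>) * L * w * (\<bar>(x - a) / w\<bar> ^ 1 * exp (- (\<alpha> / 8 * t x))))"
      proof (rule AE_I2)
        fix x
        let ?e = "exp (- (\<alpha> / 8 * t x))"
        have H: "\<bar>h (\<alpha> * t x)\<bar> \<le> L * ?e" "\<bar>t x * h' (\<alpha> * t x)\<bar> \<le> L * ?e"
          using Lh[OF t0[of x], of \<alpha>] Lh1[OF t0[of x], of \<alpha>] \<alpha> by (auto simp: mult.commute)
        have "\<bar>l * h (\<alpha> * t x) + k * \<beta> * (t x * h' (\<alpha> * t x))\<bar>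
            \<le> \<bar>l\<bar> * \<bar>h (\<alpha> * t x)\<bar> + \<bar>k * \<beta>\<bar> * \<bar>t x * h' (\<alpha> * t x)\<bar>"
          using abs_triangle_ineq[of "l * h (\<alpha> * t x)" "k * \<beta> * (t x * h' (\<alpha> * t x))"]
          unfolding abs_mult .
        also have "\<dots> \<le> \<bar>l\<bar> * (L * ?e) + \<bar>k * \<beta>\<bar> * (L * ?e)"
          using H by (intro add_mono mult_left_mono) auto
        finally have "\<bar>odd x\<bar> \<le> \<bar>x - a\<bar> * (\<bar>l\<bar> * (L * ?e) + \<bar>k * \<beta>\<bar> * (L * ?e))"
          unfolding odd_def abs_mult[of "x - a"] by (rule mult_left_mono) simp
        also have "\<dots> = (\<bar>l\<bar> + \<bar>k * \<beta>\<bar>) * L * w * (\<bar>(x - a) / w\<bar> ^ 1 * ?e)"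
          using w by (simp add: field_simps)
        also have "\<dots> = norm ((\<bar>l\<bar> + \<bar>k * \<beta>\<bar>) * L * w * (\<bar>(x - a) / w\<bar> ^ 1 * ?e))"
          using w L by simp
        finally show "norm (odd x) \<le> norm ((\<bar>l\<bar> + \<bar>k * \<beta>\<bar>) * L * w * (\<bar>(x - a) / w\<bar> ^ 1 * ?e))"
          by simp
      qed
    qed
    have e_val: "(\<integral>x. even x \<partial>lborel) = k * w * (\<integral>y. h (\<alpha> * y ^ 4) \<partial>lborel)"
      unfolding even_def t_def
      using integral_scaled[OF w, of "\<lambda>y. h (\<alpha> * y ^ 4)" a] by simp
    have o_val: "(\<integral>x. odd x \<partial>lborel) = 0"
    proof (rule integral_odd_about)
      fix x
      have "(a - x) ^ 4 = (x - a) ^ 4" by (simp add: power4_eq_xxxx algebra_simps)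
      hence "t (2 * a - x) = t x" by (simp add: t_def power_divide)
      thus "odd (2 * a - x) = - odd x" by (simp add: odd_def algebra_simps)
    qed
    have close: "\<bar>G x - (even x + odd x)\<bar> \<le> D x" for x
    proof -
      have eo: "even x + odd x = (k + l * (x - a)) * h (t x * \<alpha>) + k * \<beta> * (x - a) * (t x * h' (t x * \<alpha>))"
        by (simp add: even_def odd_def algebra_simps)
      let ?e = "(x - a)\<^sup>2 * exp (- (\<alpha> / 8 * t x))"
      have "\<bar>G x - (even x + odd x)\<bar> \<le> (if \<bar>x - a\<bar> < r then P else Q) * ?e"
      proof (cases "\<bar>x - a\<bar> < r")
        case True
        then obtain q where q: "u x = t x * q" "\<bar>q - (\<alpha> + \<beta> * (x - a))\<bar> \<le> E * (x - a)\<^sup>2"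
          "\<bar>q - \<alpha>\<bar> \<le> \<alpha> / 2" using u unfolding t_def by blast
        thus ?thesis using near[OF t0 _ \<rho> q(2,3)] True r unfolding eo by (simp add: G_def)
      next
        case False
        thus ?thesis using far[OF t0, of "x - a" x] unfolding eo by (simp add: G_def)
      qed
      also have "\<dots> \<le> (P + Q) * ?e" using P Q by (intro mult_right_mono) auto
      finally show ?thesis by (simp add: D_def)
    qed
    have Dm: "D \<in> borel_measurable lborel" using D_int by simp
    have eom: "(\<lambda>x. even x + odd x) \<in> borel_measurable lborel" using e_int o_int by simp
    \<comment> \<open>Measurability of the density and of \<open>u\<close> is known only on the
      window, so both are cut off. Outside the window \<open>h\<close> is then evaluated at 0, which
      is harmless because the other factor is 0 there.\<close>
    have Gm: "G \<in> borel_measurable lebesgue"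
    proof -
      have [measurable]: "(\<lambda>x. indicator {x. \<bar>x - a\<bar> < r} x *\<^sub>R \<rho> x) \<in> borel_measurable lebesgue"
        "(\<lambda>x. indicator {x. \<bar>x - a\<bar> < r} x *\<^sub>R u x) \<in> borel_measurable lebesgue"
        using \<rho>m um by (simp_all add: set_borel_measurable_def)
      have "G = (\<lambda>x. (indicator {x. \<bar>x - a\<bar> < r} x *\<^sub>R \<rho> x) * h (indicator {x. \<bar>x - a\<bar> < r} x *\<^sub>R u x))"
        by (auto simp: G_def indicator_def)
      also have "\<dots> \<in> borel_measurable lebesgue" by measurable
      finally show ?thesis .
    qed
    \<comment> \<open>\<open>G\<close> is known to be only Lebesgue measurable, whereas the models
      are Borel. The comparison therefore takes place in the completion, where the Borel integrals
      keep their values.\<close>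
    have Dl: "integrable lebesgue D" using D_int Dm by (simp add: integrable_completion)
    have eol: "integrable lebesgue (\<lambda>x. even x + odd x)"
      using eom e_int o_int by (simp add: integrable_completion)
    have Rl: "integrable lebesgue (\<lambda>x. G x - (even x + odd x))"
    proof (rule Bochner_Integration.integrable_bound[OF Dl])
      show "(\<lambda>x. G x - (even x + odd x)) \<in> borel_measurable lebesgue"
        using Gm borel_measurable_integrable[OF eol] by (rule borel_measurable_diff)
      show "AE x in lebesgue. norm (G x - (even x + odd x)) \<le> norm (D x)"
        using close by (intro AE_I2) (simp, meson abs_ge_self order_trans)
    qed
    have Gl: "integrable lebesgue G"
      using Bochner_Integration.integrable_add[OF Rl eol] by simp
    have "(\<integral>x. G x \<partial>lebesgue) - (\<integral>x. even x + odd x \<partial>lebesgue)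
        = (\<integral>x. G x - (even x + odd x) \<partial>lebesgue)"
      using Gl eol by simp
    also have "\<bar>\<dots>\<bar> \<le> (\<integral>x. D x \<partial>lebesgue)"
      using Bochner_Integration.integral_norm_bound_integral[OF Rl Dl] close by simp
    also have "\<dots> = (P + Q) * J * w ^ 3"
      using D_val integral_completion[OF Dm] by simp
    finally have fin: "\<bar>(\<integral>x. G x \<partial>lebesgue) - (\<integral>x. even x + odd x \<partial>lebesgue)\<bar> \<le> (P + Q) * J * w ^ 3" .
    have "(\<integral>x. even x + odd x \<partial>lebesgue) = k * w * (\<integral>y. h (\<alpha> * y ^ 4) \<partial>lborel)"
      using integral_completion[OF eom] e_int o_int e_val o_val by simp
    thus ?case using fin Gl unfolding G_def set_integrable_def set_lebesgue_integral_def by simp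
  qed
qed

section \<open>The constants of the quartic integral\<close>

text \<open>A nonnegative integrand has integral 0 only if it vanishes almost everywhere, but the
  exponential vanishes nowhere and the line is not a null set. This yields the positivity of
  \<open>K\<close>.\<close>

lemma integral_exp_quartic_pos:
  fixes \<alpha> :: real
  assumes "\<alpha> > 0"
  shows "(\<integral>y. exp (- (\<alpha> * y ^ 4)) \<partial>lborel) > 0"
proof -
  have int: "integrable lborel (\<lambda>y::real. exp (- (\<alpha> * y ^ 4)))"
    using integrable_power_exp_quartic[OF assms, of 0] by simp
  have "(\<integral>y. exp (- (\<alpha> * y ^ 4)) \<partial>lborel) \<noteq> 0"
    by (subst integral_nonneg_eq_0_iff_AE[OF int])
      (auto simp: AE_iff_null emeasure_lborel_UNIV null_sets_def)
  moreover have "(\<integral>y. exp (- (\<alpha> * y ^ 4)) \<partial>lborel) \<ge> 0" by simp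
  ultimately show ?thesis by linarith
qed

text \<open>Equipartition for a quartic potential: the mean of \<open>\<alpha> * y ^ 4\<close> is
  one over the degree. This is the source of the term \<open>T\<^sub>c / 4\<close>. The
  antiderivative \<open>?F\<close> tends to 0 at both ends of the line.\<close>

lemma quartic_equipartition:
  fixes \<alpha> :: real
  assumes "\<alpha> > 0"
  shows "(\<integral>y. (\<alpha> * y ^ 4 - 1 / 4) * exp (- (\<alpha> * y ^ 4)) \<partial>lborel) = 0"
proof -
  let ?f = "\<lambda>y. (\<alpha> * y ^ 4 - 1 / 4) * exp (- (\<alpha> * y ^ 4))"
  let ?F = "\<lambda>y. - (y / 4) * exp (- (\<alpha> * y ^ 4))"
  have "integrable lborel (\<lambda>y. \<alpha> * (\<bar>y\<bar> ^ 4 * exp (- (\<alpha> * y ^ 4))) - 1 / 4 * (\<bar>y\<bar> ^ 0 * exp (- (\<alpha> * y ^ 4))))"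
    by (intro Bochner_Integration.integrable_diff integrable_mult_right integrable_power_exp_quartic assms)
  also have "(\<lambda>y. \<alpha> * (\<bar>y\<bar> ^ 4 * exp (- (\<alpha> * y ^ 4))) - 1 / 4 * (\<bar>y\<bar> ^ 0 * exp (- (\<alpha> * y ^ 4)))) = ?f"
    by (auto simp: algebra_simps)
  finally have int: "integrable lborel ?f" .
  have "(LBINT y=-\<infinity>..\<infinity>. ?f y) = 0 - 0"
  proof (rule interval_integral_FTC_integrable[where F = ?F])
    fix y :: real
    have "(?F has_real_derivative ?f y) (at y)"
      by (rule derivative_eq_intros refl | simp add: algebra_simps eval_nat_numeral)+
    thus "(?F has_vector_derivative ?f y) (at y)"
      by (simp add: has_real_derivative_iff_has_vector_derivative)
    show "isCont ?f y" by simp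
  next
    show "set_integrable lborel (einterval (- \<infinity>) \<infinity>) ?f"
      using int by (simp add: set_integrable_def einterval_eq_UNIV)
    have "(?F \<longlongrightarrow> 0) at_bot" using assms by real_asymp
    thus "((?F \<circ> real_of_ereal) \<longlongrightarrow> 0) (at_right (- \<infinity>))"
      by (simp add: ereal_tendsto_simps)
    have "(?F \<longlongrightarrow> 0) at_top" using assms by real_asymp
    thus "((?F \<circ> real_of_ereal) \<longlongrightarrow> 0) (at_left \<infinity>)"
      by (simp add: ereal_tendsto_simps)
  qed simp
  thus ?thesis
    by (simp add: interval_lebesgue_integral_def set_lebesgue_integral_def einterval_eq_UNIV)
qed

text \<open>Supplies the decay hypotheses for the weight \<open>(s - 1 / 4) * exp (- s)\<close> and
  its first two derivatives, which up to sign have the same form with \<open>c\<close> equal to 1/4,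
  5/4 and 9/4.\<close>

lemma exp_minus_le_exp_half:
  fixes s c :: real
  assumes "s \<ge> 0" "0 \<le> c" "c \<le> 3"
  shows "\<bar>s - c\<bar> * exp (- s) \<le> 3 * exp (- s / 2)"
proof -
  have "\<bar>s - c\<bar> \<le> 3 * (1 + s / 2)" using assms by (simp add: abs_le_iff)
  also have "\<dots> \<le> 3 * exp (s / 2)" by (intro mult_left_mono exp_ge_add_one_self) simp
  finally have "\<bar>s - c\<bar> * exp (- s) \<le> 3 * exp (s / 2) * exp (- s)"
    by (rule mult_right_mono) simp
  also have "\<dots> = 3 * exp (- s / 2)" by (simp add: mult.assoc mult_exp_exp)
  finally show ?thesis .
qed

section \<open>Asymptotics on a window around the critical point\<close>

text \<open>The Laplace estimate at scale \<open>w = g powr (1/4)\<close>, for both weights at once.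
  All radii up to \<open>R\<close> are covered with the same leading constant, because the partition
  function needs every small window while the average needs one window to split at.\<close>

lemma quartic_laplace_local:
  fixes D :: "real set" and \<phi> :: "real \<Rightarrow> real" and \<rho> :: "real \<Rightarrow> real \<Rightarrow> real"
  assumes density: "regular_density D a g\<^sub>0 \<rho> N" and g0: "g\<^sub>0 > 0" and a: "a \<in> interior D"
    and \<phi>: "continuous_on D \<phi>"
    and \<alpha>: "\<alpha> > 0" and r0: "r\<^sub>0 > 0" and E: "E \<ge> 0"
    and expansion: "\<And>x. \<bar>x - a\<bar> \<le> r\<^sub>0 \<Longrightarrow> \<exists>q. \<phi> x = (x - a) ^ 4 * q \<and>
      \<bar>q - (\<alpha> + \<beta> * (x - a))\<bar> \<le> E * (x - a)\<^sup>2"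
  shows "\<exists>\<rho>0>0. \<exists>R>0. \<forall>r. 0 < r \<and> r \<le> R \<longrightarrow>
    {x. \<bar>x - a\<bar> < r} \<subseteq> D \<and>
    (\<forall>\<^sub>F g in at_right 0.
       set_integrable lebesgue {x. \<bar>x - a\<bar> < r} (\<lambda>x. \<rho> x g * exp (- (\<phi> x / g)))) \<and>
    (\<lambda>g. (LINT x:{x. \<bar>x - a\<bar> < r}|lebesgue. \<rho> x g * exp (- (\<phi> x / g)))
       - \<rho>0 * (\<integral>y. exp (- (\<alpha> * y ^ 4)) \<partial>lborel) * g powr (1/4)) \<in> O[at_right 0](\<lambda>g. g powr (3/4)) \<and>
    (\<forall>\<^sub>F g in at_right 0. set_integrable lebesgue {x. \<bar>x - a\<bar> < r}
       (\<lambda>x. \<rho> x g * ((\<phi> x / g - 1 / 4) * exp (- (\<phi> x / g))))) \<and>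
    (\<lambda>g. LINT x:{x. \<bar>x - a\<bar> < r}|lebesgue. \<rho> x g * ((\<phi> x / g - 1 / 4) * exp (- (\<phi> x / g))))
       \<in> O[at_right 0](\<lambda>g. g powr (3/4))"
proof -
  obtain \<rho>0 \<rho>1 d C where \<rho>0: "\<rho>0 > 0" and d: "d > 0"
    and \<rho>: "\<And>g \<delta>. g \<in> {0<..<g\<^sub>0} \<Longrightarrow> \<bar>\<delta>\<bar> < d \<Longrightarrow> \<bar>\<rho> (a + \<delta>) g - (\<rho>0 + \<rho>1 * \<delta>)\<bar> \<le> C * \<delta>\<^sup>2"
    using density unfolding regular_density_def by blast
  have \<rho>m: "set_borel_measurable lebesgue D (\<lambda>x. \<rho> x g)" if "g \<in> {0<..<g\<^sub>0}" for g
    using density that unfolding regular_density_def by blast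
  obtain e where e: "e > 0" "ball a e \<subseteq> D" using a mem_interior by blast
  \<comment> \<open>The bounds serve in turn to make squares of distances at most the distances, to
    stay in the ranges of the two expansions, to stay inside \<open>D\<close>, and to force
    \<open>\<bar>q - \<alpha>\<bar> \<le> \<alpha> / 2\<close>. The summand 1 keeps the last
    denominator positive.\<close>
  define R where "R = min 1 (min r\<^sub>0 (min d (min e (\<alpha> / (2 * (\<bar>\<beta>\<bar> + E + 1))))))"
  have R: "R > 0" "R \<le> 1" "R \<le> r\<^sub>0" "R \<le> d" "R \<le> e"
    using r0 d e \<alpha> E by (auto simp: R_def intro!: divide_pos_pos)
  have R6: "R \<le> \<alpha> / (2 * (\<bar>\<beta>\<bar> + E + 1))"
    unfolding R_def by (intro min.coboundedI2 order_refl)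
  have sub: "{x. \<bar>x - a\<bar> < r} \<subseteq> D" if "0 < r" "r \<le> R" for r
    using e(2) R(5) that by (force simp: dist_real_def abs_minus_commute)
  have main: "(\<forall>\<^sub>F g in at_right 0.
        set_integrable lebesgue {x. \<bar>x - a\<bar> < r} (\<lambda>x. \<rho> x g * h (\<phi> x / g))) \<and>
      (\<lambda>g. (LINT x:{x. \<bar>x - a\<bar> < r}|lebesgue. \<rho> x g * h (\<phi> x / g))
         - \<rho>0 * g powr (1/4) * (\<integral>y. h (\<alpha> * y ^ 4) \<partial>lborel)) \<in> O[at_right 0](\<lambda>g. g powr (3/4))"
    if r: "0 < r" "r \<le> R" and h: "\<And>s. (h has_real_derivative h' s) (at s)"
      "\<And>s. (h' has_real_derivative h'' s) (at s)"
      "\<And>s. s \<ge> 0 \<Longrightarrow> \<bar>h s\<bar> \<le> K * exp (- s / 2)"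
      "\<And>s. s \<ge> 0 \<Longrightarrow> \<bar>h' s\<bar> \<le> K * exp (- s / 2)"
      "\<And>s. s \<ge> 0 \<Longrightarrow> \<bar>h'' s\<bar> \<le> K * exp (- s / 2)"
    for r K and h h' h'' :: "real \<Rightarrow> real"
  proof -
    have r1: "r \<le> 1" using r R by simp
    \<comment> \<open>The density hypothesis fixes no sign for \<open>C\<close>, so
      \<open>\<bar>C\<bar>\<close> takes its place.\<close>
    have "\<exists>B. \<forall>w p u. w > 0 \<longrightarrow>
      set_borel_measurable lebesgue {x. \<bar>x - a\<bar> < r} p \<longrightarrow>
      set_borel_measurable lebesgue {x. \<bar>x - a\<bar> < r} u \<longrightarrow>
      (\<forall>x. \<bar>x - a\<bar> < r \<longrightarrow> \<bar>p x - (\<rho>0 + \<rho>1 * (x - a))\<bar> \<le> \<bar>C\<bar> * (x - a)\<^sup>2) \<longrightarrow>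
      (\<forall>x. \<bar>x - a\<bar> < r \<longrightarrow> (\<exists>q. u x = ((x - a) / w) ^ 4 * q \<and>
         \<bar>q - (\<alpha> + \<beta> * (x - a))\<bar> \<le> E * (x - a)\<^sup>2 \<and> \<bar>q - \<alpha>\<bar> \<le> \<alpha> / 2)) \<longrightarrow>
      set_integrable lebesgue {x. \<bar>x - a\<bar> < r} (\<lambda>x. p x * h (u x)) \<and>
      \<bar>(LINT x:{x. \<bar>x - a\<bar> < r}|lebesgue. p x * h (u x))
         - \<rho>0 * w * (\<integral>y. h (\<alpha> * y ^ 4) \<partial>lborel)\<bar> \<le> B * w ^ 3"
      (is "\<exists>B. ?bound B")
      by (rule quartic_laplace[OF h \<alpha> r(1) r1 abs_ge_zero[of C] E]) simp_all
    then obtain B where "?bound B" by blast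
    note B = this[rule_format]
    have ev: "\<forall>\<^sub>F g in at_right 0. g \<in> {0<..<g\<^sub>0}"
      using eventually_at_right_real[OF g0] .
    have concl: "set_integrable lebesgue {x. \<bar>x - a\<bar> < r} (\<lambda>x. \<rho> x g * h (\<phi> x / g)) \<and>
      \<bar>(LINT x:{x. \<bar>x - a\<bar> < r}|lebesgue. \<rho> x g * h (\<phi> x / g))
         - \<rho>0 * g powr (1/4) * (\<integral>y. h (\<alpha> * y ^ 4) \<partial>lborel)\<bar> \<le> B * (g powr (1/4)) ^ 3"
      if g: "g \<in> {0<..<g\<^sub>0}" for g
    proof (rule B)
      have ball: "{x. \<bar>x - a\<bar> < r} = ball a r"
        by (auto simp: dist_real_def abs_minus_commute)
      show "0 < g powr (1/4)" using g by simp
      show "set_borel_measurable lebesgue {x. \<bar>x - a\<bar> < r} (\<lambda>x. \<rho> x g)"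
        by (rule set_borel_measurable_subset[OF \<rho>m[OF g] _ sub[OF r]]) (simp add: ball)
      have "(\<lambda>x. indicator {x. \<bar>x - a\<bar> < r} x *\<^sub>R (\<phi> x / g)) \<in> borel_measurable borel"
        unfolding ball
        using continuous_on_subset[OF \<phi> sub[OF r]] g
        by (intro borel_measurable_continuous_on_indicator continuous_intros) (auto simp: ball)
      thus "set_borel_measurable lebesgue {x. \<bar>x - a\<bar> < r} (\<lambda>x. \<phi> x / g)"
        unfolding set_borel_measurable_def by (intro measurable_completion) simp
    next
      fix x assume x: "\<bar>x - a\<bar> < r"
      have "\<bar>\<rho> x g - (\<rho>0 + \<rho>1 * (x - a))\<bar> \<le> C * (x - a)\<^sup>2"
        using \<rho>[OF g, of "x - a"] x r R by simp
      also have "\<dots> \<le> \<bar>C\<bar> * (x - a)\<^sup>2" by (intro mult_right_mono) auto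
      finally show "\<bar>\<rho> x g - (\<rho>0 + \<rho>1 * (x - a))\<bar> \<le> \<bar>C\<bar> * (x - a)\<^sup>2" .
      obtain q where q: "\<phi> x = (x - a) ^ 4 * q" "\<bar>q - (\<alpha> + \<beta> * (x - a))\<bar> \<le> E * (x - a)\<^sup>2"
        using expansion[of x] x r R by auto
      have "(g powr (1/4)) ^ 4 = g" using g by (simp flip: powr_realpow add: powr_powr)
      hence "\<phi> x / g = ((x - a) / g powr (1/4)) ^ 4 * q" using q(1) by (simp add: power_divide)
      moreover have "\<bar>q - \<alpha>\<bar> \<le> \<alpha> / 2"
      proof -
        have "\<bar>x - a\<bar> * \<bar>x - a\<bar> \<le> \<bar>x - a\<bar> * 1" using x r1 by (intro mult_left_mono) auto
        hence "(x - a)\<^sup>2 \<le> \<bar>x - a\<bar>" by (simp add: power2_eq_square)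
        hence "E * (x - a)\<^sup>2 \<le> E * \<bar>x - a\<bar>" using E by (rule mult_left_mono)
        moreover have "\<bar>q - \<alpha>\<bar> \<le> \<bar>q - (\<alpha> + \<beta> * (x - a))\<bar> + \<bar>\<beta>\<bar> * \<bar>x - a\<bar>"
          using abs_triangle_ineq[of "q - (\<alpha> + \<beta> * (x - a))" "\<beta> * (x - a)"] by (simp add: abs_mult)
        moreover have "(\<bar>\<beta>\<bar> + E + 1) * \<bar>x - a\<bar> = \<bar>\<beta>\<bar> * \<bar>x - a\<bar> + E * \<bar>x - a\<bar> + \<bar>x - a\<bar>"
          by (simp add: distrib_right)
        ultimately have "\<bar>q - \<alpha>\<bar> \<le> (\<bar>\<beta>\<bar> + E + 1) * \<bar>x - a\<bar>"
          using q(2) by linarith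
        also have "\<dots> \<le> (\<bar>\<beta>\<bar> + E + 1) * (\<alpha> / (2 * (\<bar>\<beta>\<bar> + E + 1)))"
          using x r R6 E by (intro mult_left_mono) auto
        also have "\<dots> = \<alpha> / 2"
        proof -
          have "b * (\<alpha> / (2 * b)) = \<alpha> / 2" if "b > 0" for b
            using that by simp
          thus ?thesis by this (use E in linarith)
        qed
        finally show ?thesis .
      qed
      ultimately show "\<exists>q. \<phi> x / g = ((x - a) / g powr (1/4)) ^ 4 * q \<and>
         \<bar>q - (\<alpha> + \<beta> * (x - a))\<bar> \<le> E * (x - a)\<^sup>2 \<and> \<bar>q - \<alpha>\<bar> \<le> \<alpha> / 2"
        using q(2) by blast
    qed
    have "\<forall>\<^sub>F g in at_right 0. set_integrable lebesgue {x. \<bar>x - a\<bar> < r} (\<lambda>x. \<rho> x g * h (\<phi> x / g))"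
      using ev by (rule eventually_mono) (rule concl[THEN conjunct1])
    moreover have "(\<lambda>g. (LINT x:{x. \<bar>x - a\<bar> < r}|lebesgue. \<rho> x g * h (\<phi> x / g))
         - \<rho>0 * g powr (1/4) * (\<integral>y. h (\<alpha> * y ^ 4) \<partial>lborel)) \<in> O[at_right 0](\<lambda>g. g powr (3/4))"
    proof (rule bigoI[of _ B])
      show "\<forall>\<^sub>F g in at_right 0. norm ((LINT x:{x. \<bar>x - a\<bar> < r}|lebesgue. \<rho> x g * h (\<phi> x / g))
         - \<rho>0 * g powr (1/4) * (\<integral>y. h (\<alpha> * y ^ 4) \<partial>lborel)) \<le> B * norm (g powr (3/4))"
        using ev
      proof eventually_elim
        case (elim g)
        have "(g powr (1/4)) ^ 3 = g powr (3/4)" using elim by (simp flip: powr_realpow add: powr_powr)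
        thus ?case using concl[OF elim] by simp
      qed
    qed
    ultimately show ?thesis ..
  qed
  have A: "(\<forall>\<^sub>F g in at_right 0.
        set_integrable lebesgue {x. \<bar>x - a\<bar> < r} (\<lambda>x. \<rho> x g * exp (- (\<phi> x / g)))) \<and>
      (\<lambda>g. (LINT x:{x. \<bar>x - a\<bar> < r}|lebesgue. \<rho> x g * exp (- (\<phi> x / g)))
         - \<rho>0 * g powr (1/4) * (\<integral>y. exp (- (\<alpha> * y ^ 4)) \<partial>lborel)) \<in> O[at_right 0](\<lambda>g. g powr (3/4))"
    if "0 < r" "r \<le> R" for r
    by (rule main[OF that, where h = "\<lambda>s. exp (- s)" and h' = "\<lambda>s. - exp (- s)" and h'' = "\<lambda>s. exp (- s)" and K = 1])
      (auto intro!: derivative_eq_intros)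
  have B: "(\<forall>\<^sub>F g in at_right 0. set_integrable lebesgue {x. \<bar>x - a\<bar> < r}
          (\<lambda>x. \<rho> x g * ((\<phi> x / g - 1 / 4) * exp (- (\<phi> x / g))))) \<and>
      (\<lambda>g. (LINT x:{x. \<bar>x - a\<bar> < r}|lebesgue. \<rho> x g * ((\<phi> x / g - 1 / 4) * exp (- (\<phi> x / g))))
         - \<rho>0 * g powr (1/4) * (\<integral>y. (\<alpha> * y ^ 4 - 1 / 4) * exp (- (\<alpha> * y ^ 4)) \<partial>lborel))
        \<in> O[at_right 0](\<lambda>g. g powr (3/4))"
    if "0 < r" "r \<le> R" for r
  proof (rule main[OF that, where h = "\<lambda>s. (s - 1 / 4) * exp (- s)"
        and h' = "\<lambda>s. - (s - 5 / 4) * exp (- s)" and h'' = "\<lambda>s. (s - 9 / 4) * exp (- s)" and K = 3])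
    fix s :: real
    show "((\<lambda>s. (s - 1 / 4) * exp (- s)) has_real_derivative - (s - 5 / 4) * exp (- s)) (at s)"
      "((\<lambda>s. - (s - 5 / 4) * exp (- s)) has_real_derivative (s - 9 / 4) * exp (- s)) (at s)"
      by (rule derivative_eq_intros refl | simp add: algebra_simps)+
    assume s: "s \<ge> 0"
    show "\<bar>(s - 1 / 4) * exp (- s)\<bar> \<le> 3 * exp (- s / 2)"
      "\<bar>- (s - 5 / 4) * exp (- s)\<bar> \<le> 3 * exp (- s / 2)"
      "\<bar>(s - 9 / 4) * exp (- s)\<bar> \<le> 3 * exp (- s / 2)"
      using exp_minus_le_exp_half[OF s, of "1/4"] exp_minus_le_exp_half[OF s, of "5/4"]
        exp_minus_le_exp_half[OF s, of "9/4"]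
      by (simp_all add: abs_mult abs_minus_commute)
  qed
  show ?thesis
  proof (rule exI[of _ \<rho>0], intro exI[of _ R] conjI \<rho>0 R(1) allI impI)
    fix r assume "0 < r \<and> r \<le> R"
    hence r: "0 < r" "r \<le> R" by simp_all
    note A = A[OF r] and B = B[OF r, unfolded quartic_equipartition[OF \<alpha>] mult_zero_right diff_zero]
    show "{x. \<bar>x - a\<bar> < r} \<subseteq> D" by (rule sub[OF r])
    show "\<forall>\<^sub>F g in at_right 0.
       set_integrable lebesgue {x. \<bar>x - a\<bar> < r} (\<lambda>x. \<rho> x g * exp (- (\<phi> x / g)))"
      using A ..
    show "(\<lambda>g. (LINT x:{x. \<bar>x - a\<bar> < r}|lebesgue. \<rho> x g * exp (- (\<phi> x / g)))
       - \<rho>0 * (\<integral>y. exp (- (\<alpha> * y ^ 4)) \<partial>lborel) * g powr (1/4)) \<in> O[at_right 0](\<lambda>g. g powr (3/4))"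
      using A[THEN conjunct2] unfolding mult.assoc mult.commute[of "_ powr _"] .
    show "\<forall>\<^sub>F g in at_right 0. set_integrable lebesgue {x. \<bar>x - a\<bar> < r}
       (\<lambda>x. \<rho> x g * ((\<phi> x / g - 1 / 4) * exp (- (\<phi> x / g))))"
      using B ..
    show "(\<lambda>g. LINT x:{x. \<bar>x - a\<bar> < r}|lebesgue. \<rho> x g * ((\<phi> x / g - 1 / 4) * exp (- (\<phi> x / g))))
       \<in> O[at_right 0](\<lambda>g. g powr (3/4))"
      using B ..
  qed
qed

section \<open>From the window to the whole interval\<close>

text \<open>Apart from its open interior, \<open>D\<close> consists of frontier points; the frontier
  of a convex set is negligible, and so are its subsets.\<close>

lemma is_interval_lebesgue_sets:
  fixes D :: "real set"
  assumes "is_interval D"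
  shows "D \<in> sets lebesgue"
proof -
  have "negligible (D \<inter> frontier D)"
    using negligible_convex_frontier[of D] assms
    by (auto intro: negligible_subset simp: is_interval_convex_1)
  hence "D \<inter> frontier D \<in> sets lebesgue" by (rule negligible_imp_sets)
  moreover have "interior D \<in> sets lebesgue" by simp
  ultimately have "interior D \<union> (D \<inter> frontier D) \<in> sets lebesgue" by blast
  moreover have "interior D \<union> (D \<inter> frontier D) = D"
    using interior_subset[of D] closure_subset[of D] by (auto simp: frontier_def)
  ultimately show ?thesis by simp
qed

text \<open>The interval is split at a fixed window. Inside, the local asymptotics apply; outside,
  dominance makes both integrals exponentially small. The numerator is thus
  \<open>O(g powr (3/4))\<close> while the denominator is of exact order
  \<open>g powr (1/4)\<close>, which leaves \<open>g powr (1/2)\<close> for the quotient. The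
  integrability claims allow the Gibbs average to be decomposed later.\<close>

lemma quartic_laplace_average:
  fixes D X :: "real set" and \<phi> :: "real \<Rightarrow> real" and \<rho> :: "real \<Rightarrow> real \<Rightarrow> real"
  assumes density: "regular_density D a g\<^sub>0 \<rho> N" and g0: "g\<^sub>0 > 0"
    and dominant: "unique_dominant_interior_minimum D a \<rho> I"
    and I: "\<And>g x. I g x - I g a = \<phi> x / g"
    and D: "is_interval D" "D \<subseteq> X" "open X" and \<phi>: "continuous_on X \<phi>"
    and \<alpha>: "\<alpha> > 0" and r0: "r\<^sub>0 > 0" and E: "E \<ge> 0"
    and expansion: "\<forall>x. \<bar>x - a\<bar> \<le> r\<^sub>0 \<longrightarrow> (\<exists>q. \<phi> x = (x - a) ^ 4 * q \<and>
      \<bar>q - (\<alpha> + \<beta> * (x - a))\<bar> \<le> E * (x - a)\<^sup>2)"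
  shows "\<forall>\<^sub>F g in at_right 0. set_integrable lebesgue D (\<lambda>x. \<rho> x g * exp (- (\<phi> x / g)))"
    and "\<forall>\<^sub>F g in at_right 0.
      set_integrable lebesgue D (\<lambda>x. \<rho> x g * ((\<phi> x / g - 1 / 4) * exp (- (\<phi> x / g))))"
    and "\<forall>\<^sub>F g in at_right 0. (LINT x:D|lebesgue. \<rho> x g * exp (- (\<phi> x / g))) > 0"
    and "(\<lambda>g. (LINT x:D|lebesgue. \<rho> x g * ((\<phi> x / g - 1 / 4) * exp (- (\<phi> x / g)))) /
        (LINT x:D|lebesgue. \<rho> x g * exp (- (\<phi> x / g)))) \<in> O[at_right 0](\<lambda>g. g powr (1/2))"
    and "\<forall>\<^sub>F r in at_right 0. \<exists>K>0.
      (\<lambda>g. LINT x:{x. \<bar>x - a\<bar> < r}|lebesgue. \<rho> x g * exp (- (\<phi> x / g)))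
        \<sim>[at_right 0] (\<lambda>g. K * g powr (1/4))"
proof -
  have a: "a \<in> interior D" using dominant by (simp add: unique_dominant_interior_minimum_def)
  have Dl: "D \<in> sets lebesgue" using D(1) by (rule is_interval_lebesgue_sets)
  define f where "f g x = \<rho> x g * exp (- (\<phi> x / g))" for g x
  define h where "h g x = \<rho> x g * ((\<phi> x / g - 1 / 4) * exp (- (\<phi> x / g)))" for g x
  define \<kappa> where "\<kappa> = (\<integral>y. exp (- (\<alpha> * y ^ 4)) \<partial>lborel)"
  have \<kappa>: "\<kappa> > 0" unfolding \<kappa>_def using \<alpha> by (rule integral_exp_quartic_pos)
  have "\<exists>\<rho>0>0. \<exists>R>0. \<forall>r. 0 < r \<and> r \<le> R \<longrightarrow>
    {x. \<bar>x - a\<bar> < r} \<subseteq> D \<and>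
    (\<forall>\<^sub>F g in at_right 0. set_integrable lebesgue {x. \<bar>x - a\<bar> < r} (f g)) \<and>
    (\<lambda>g. (LINT x:{x. \<bar>x - a\<bar> < r}|lebesgue. f g x) - \<rho>0 * \<kappa> * g powr (1/4))
       \<in> O[at_right 0](\<lambda>g. g powr (3/4)) \<and>
    (\<forall>\<^sub>F g in at_right 0. set_integrable lebesgue {x. \<bar>x - a\<bar> < r} (h g)) \<and>
    (\<lambda>g. LINT x:{x. \<bar>x - a\<bar> < r}|lebesgue. h g x) \<in> O[at_right 0](\<lambda>g. g powr (3/4))"
    (is "\<exists>\<rho>0>0. \<exists>R>0. ?P \<rho>0 R")
    unfolding f_def h_def \<kappa>_def
    by (rule quartic_laplace_local[OF density g0 a continuous_on_subset[OF \<phi> D(2)] \<alpha> r0 E expansion[rule_format]])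
  then obtain \<rho>0 R where \<rho>0: "\<rho>0 > 0" and R: "R > 0" and local: "?P \<rho>0 R" by blast
  note local = local[rule_format, OF conjI]
  note sub = local[THEN conjunct1]
    and f_int = local[THEN conjunct2, THEN conjunct1]
    and f_val = local[THEN conjunct2, THEN conjunct2, THEN conjunct1]
    and h_int = local[THEN conjunct2, THEN conjunct2, THEN conjunct2, THEN conjunct1]
    and h_val = local[THEN conjunct2, THEN conjunct2, THEN conjunct2, THEN conjunct2]
  have small: "(\<lambda>g. g powr (3/4)) \<in> o[at_right 0](\<lambda>g::real. \<rho>0 * \<kappa> * g powr (1/4))"
    using \<rho>0 \<kappa> by real_asymp
  have equiv: "F \<sim>[at_right 0] (\<lambda>g. \<rho>0 * \<kappa> * g powr (1/4))"
    if "(\<lambda>g. F g - \<rho>0 * \<kappa> * g powr (1/4)) \<in> O[at_right 0](\<lambda>g. g powr (3/4))" for F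
    unfolding asymp_equiv_altdef using that small by (rule landau_o.big_small_trans)
  show "\<forall>\<^sub>F r in at_right 0. \<exists>K>0.
      (\<lambda>g. LINT x:{x. \<bar>x - a\<bar> < r}|lebesgue. \<rho> x g * exp (- (\<phi> x / g)))
        \<sim>[at_right 0] (\<lambda>g. K * g powr (1/4))"
    using eventually_at_right_real[OF R]
  proof eventually_elim
    case (elim r)
    thus ?case using equiv[OF f_val[of r]] \<rho>0 \<kappa> unfolding f_def
      by (intro exI[of _ "\<rho>0 * \<kappa>"]) auto
  qed
  have "\<forall>\<^sub>F r in at_right 0. \<exists>c>0.
        (\<forall>\<^sub>F g in at_right 0. set_integrable lebesgue (D - {a - r<..<a + r})
           (\<lambda>x. \<rho> x g * (1 + \<bar>\<phi> x / g\<bar>) * exp (- (\<phi> x / g)))) \<and>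
        (\<lambda>g. LINT x:(D - {a - r<..<a + r})|lebesgue.
           \<rho> x g * (1 + \<bar>\<phi> x / g\<bar>) * exp (- (\<phi> x / g)))
          \<in> O[at_right 0](\<lambda>g. exp (- c / g))"
    using dominant unfolding unique_dominant_interior_minimum_def I by blast
  with eventually_at_right_real[OF R]
  have "\<forall>\<^sub>F r in at_right 0. r \<in> {0<..<R} \<and> (\<exists>c>0.
        (\<forall>\<^sub>F g in at_right 0. set_integrable lebesgue (D - {a - r<..<a + r})
           (\<lambda>x. \<rho> x g * (1 + \<bar>\<phi> x / g\<bar>) * exp (- (\<phi> x / g)))) \<and>
        (\<lambda>g. LINT x:(D - {a - r<..<a + r})|lebesgue.
           \<rho> x g * (1 + \<bar>\<phi> x / g\<bar>) * exp (- (\<phi> x / g)))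
          \<in> O[at_right 0](\<lambda>g. exp (- c / g)))"
    by (rule eventually_conj)
  \<comment> \<open>Dominance and the local asymptotics each hold for all small radii, so one radius
    serves both; it stays fixed from here on.\<close>
  from eventually_happens'[OF trivial_limit_at_right_real this]
  obtain r c where rR: "r \<in> {0<..<R}" and c: "c > 0"
    and t_int: "\<forall>\<^sub>F g in at_right 0. set_integrable lebesgue (D - {a - r<..<a + r})
           (\<lambda>x. \<rho> x g * (1 + \<bar>\<phi> x / g\<bar>) * exp (- (\<phi> x / g)))"
    and t_val: "(\<lambda>g. LINT x:(D - {a - r<..<a + r})|lebesgue.
           \<rho> x g * (1 + \<bar>\<phi> x / g\<bar>) * exp (- (\<phi> x / g))) \<in> O[at_right 0](\<lambda>g. exp (- c / g))"
    by blast
  from rR have r: "0 < r" "r \<le> R" by auto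
  define W where "W = D - {a - r<..<a + r}"
  define b where "b g x = \<rho> x g * (1 + \<bar>\<phi> x / g\<bar>) * exp (- (\<phi> x / g))" for g x
  have Wl: "W \<in> sets lebesgue" using Dl by (simp add: W_def sets.Diff)
  have D_eq: "D = {x. \<bar>x - a\<bar> < r} \<union> W" "{x. \<bar>x - a\<bar> < r} \<inter> W = {}"
    using sub[OF r] by (auto simp: W_def abs_less_iff)
  have ball: "{x. \<bar>x - a\<bar> < r} \<in> sets lebesgue"
  proof -
    have "{x. \<bar>x - a\<bar> < r} = ball a r" by (auto simp: dist_real_def abs_minus_commute)
    thus ?thesis by simp
  qed
  have ev: "\<forall>\<^sub>F g in at_right 0. g \<in> {0<..<g\<^sub>0} \<and> set_integrable lebesgue W (b g)"
    using eventually_conj[OF eventually_at_right_real[OF g0] t_int] unfolding W_def b_def .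
  \<comment> \<open>The majorant \<open>(1 + \<bar>u\<bar>) * exp (- u)\<close> is the one in the
    dominance hypothesis. It covers both weights, because
    \<open>\<bar>u - 1 / 4\<bar> \<le> 1 + \<bar>u\<bar>\<close>.\<close>
  have tail: "set_integrable lebesgue W (\<lambda>x. \<rho> x g * k (\<phi> x / g)) \<and>
      norm (LINT x:W|lebesgue. \<rho> x g * k (\<phi> x / g)) \<le> 1 * norm (LINT x:W|lebesgue. b g x)"
    if g: "g \<in> {0<..<g\<^sub>0} \<and> set_integrable lebesgue W (b g)" and k: "continuous_on UNIV k"
      "\<And>u. \<bar>k u\<bar> \<le> (1 + \<bar>u\<bar>) * exp (- u)" for k :: "real \<Rightarrow> real" and g
  proof -
    have pos: "\<rho> x g \<ge> 0" if "x \<in> D" for x using density g that unfolding regular_density_def by blast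
    have le: "\<bar>\<rho> x g * k (\<phi> x / g)\<bar> \<le> b g x" if "x \<in> W" for x
    proof -
      have p: "\<rho> x g \<ge> 0" using pos that by (simp add: W_def)
      have "\<rho> x g * \<bar>k (\<phi> x / g)\<bar> \<le> \<rho> x g * ((1 + \<bar>\<phi> x / g\<bar>) * exp (- (\<phi> x / g)))"
        by (rule mult_left_mono[OF k(2) p])
      thus ?thesis using p by (simp add: b_def abs_mult mult.assoc)
    qed
    have m1: "set_borel_measurable lebesgue W (\<lambda>x. \<rho> x g)"
    proof (rule set_borel_measurable_subset[OF _ Wl])
      show "set_borel_measurable lebesgue D (\<lambda>x. \<rho> x g)"
        using density g unfolding regular_density_def by blast
    qed (auto simp: W_def)
    \<comment> \<open>Measurability is obtained on the open set \<open>X\<close>, where \<phi> is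
      continuous, and then restricted to the Lebesgue set \<open>W\<close>.\<close>
    have "continuous_on X (\<lambda>x. k (\<phi> x / g))"
      by (rule continuous_on_compose2[OF k(1)]) (use \<phi> g in \<open>auto intro!: continuous_intros\<close>)
    hence "set_borel_measurable borel X (\<lambda>x. k (\<phi> x / g))"
      unfolding set_borel_measurable_def using D(3) by (intro borel_measurable_continuous_on_indicator) auto
    hence "set_borel_measurable lebesgue X (\<lambda>x. k (\<phi> x / g))"
      unfolding set_borel_measurable_def by (intro measurable_completion) simp
    hence m2: "set_borel_measurable lebesgue W (\<lambda>x. k (\<phi> x / g))"
      by (rule set_borel_measurable_subset[OF _ Wl]) (use D(2) in \<open>auto simp: W_def\<close>)
    have "(\<lambda>x. indicator W x *\<^sub>R (\<rho> x g * k (\<phi> x / g)))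
        = (\<lambda>x. (indicator W x *\<^sub>R \<rho> x g) * (indicator W x *\<^sub>R k (\<phi> x / g)))"
      by (auto simp: indicator_def)
    hence m: "set_borel_measurable lebesgue W (\<lambda>x. \<rho> x g * k (\<phi> x / g))"
      using m1 m2 unfolding set_borel_measurable_def by simp
    have int: "set_integrable lebesgue W (\<lambda>x. \<rho> x g * k (\<phi> x / g))"
    proof (rule set_integrable_bound[OF _ m])
      show "set_integrable lebesgue W (b g)" using g ..
      show "AE x in lebesgue. x \<in> W \<longrightarrow> norm (\<rho> x g * k (\<phi> x / g)) \<le> norm (b g x)"
        by (rule AE_I2) (use le abs_ge_self order_trans in \<open>fastforce simp only: real_norm_def\<close>)
    qed
    have "norm (LINT x:W|lebesgue. \<rho> x g * k (\<phi> x / g)) \<le> (LINT x:W|lebesgue. b g x)"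
      unfolding set_lebesgue_integral_def
      using int g le unfolding set_integrable_def
      by (intro Bochner_Integration.integral_norm_bound_integral) (auto simp: indicator_def)
    thus ?thesis using int by simp
  qed
  have exp_small: "(\<lambda>g. exp (- c / g)) \<in> O[at_right 0](\<lambda>g. g powr (3/4))"
    using c by real_asymp
  have b_O: "(\<lambda>g. LINT x:W|lebesgue. b g x) \<in> O[at_right 0](\<lambda>g. g powr (3/4))"
    using landau_o.big_trans[OF t_val exp_small] unfolding W_def b_def .
  have tail_O: "(\<forall>\<^sub>F g in at_right 0. set_integrable lebesgue W (\<lambda>x. \<rho> x g * k (\<phi> x / g))) \<and>
      (\<lambda>g. LINT x:W|lebesgue. \<rho> x g * k (\<phi> x / g)) \<in> O[at_right 0](\<lambda>g. g powr (3/4))"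
    if k: "continuous_on UNIV k" "\<And>u. \<bar>k u\<bar> \<le> (1 + \<bar>u\<bar>) * exp (- u)" for k :: "real \<Rightarrow> real"
  proof
    show "\<forall>\<^sub>F g in at_right 0. set_integrable lebesgue W (\<lambda>x. \<rho> x g * k (\<phi> x / g))"
      using ev by (rule eventually_mono) (use tail[OF _ k] in blast)
    have "(\<lambda>g. LINT x:W|lebesgue. \<rho> x g * k (\<phi> x / g)) \<in> O[at_right 0](\<lambda>g. LINT x:W|lebesgue. b g x)"
      by (rule bigoI[of _ 1], rule eventually_mono[OF ev]) (use tail[OF _ k] in blast)
    thus "(\<lambda>g. LINT x:W|lebesgue. \<rho> x g * k (\<phi> x / g)) \<in> O[at_right 0](\<lambda>g. g powr (3/4))"
      using b_O by (rule landau_o.big_trans)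
  qed
  have tf: "\<forall>\<^sub>F g in at_right 0. set_integrable lebesgue W (f g)"
    "(\<lambda>g. LINT x:W|lebesgue. f g x) \<in> O[at_right 0](\<lambda>g. g powr (3/4))"
    using tail_O[OF continuous_on_exp[OF continuous_on_minus[OF continuous_on_id]]]
    unfolding f_def by (auto simp: algebra_simps)
  have "\<bar>(u - 1 / 4) * exp (- u)\<bar> \<le> (1 + \<bar>u\<bar>) * exp (- u)" for u :: real
    unfolding abs_mult abs_exp_cancel by (rule mult_right_mono) auto
  moreover have "continuous_on UNIV (\<lambda>u::real. (u - 1 / 4) * exp (- u))" by (intro continuous_intros)
  ultimately have th: "\<forall>\<^sub>F g in at_right 0. set_integrable lebesgue W (h g)"
    "(\<lambda>g. LINT x:W|lebesgue. h g x) \<in> O[at_right 0](\<lambda>g. g powr (3/4))"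
    using tail_O[of "\<lambda>u. (u - 1 / 4) * exp (- u)"] unfolding h_def by blast+
  have Df: "\<forall>\<^sub>F g in at_right 0. set_integrable lebesgue D (f g) \<and> (LINT x:D|lebesgue. f g x)
      = (LINT x:{x. \<bar>x - a\<bar> < r}|lebesgue. f g x) + (LINT x:W|lebesgue. f g x)"
    using f_int[OF r] tf(1)
  proof eventually_elim
    case (elim g)
    show ?case using set_integrable_Un[OF elim ball Wl] set_integral_Un[OF D_eq(2) elim]
      unfolding D_eq(1)[symmetric] by simp
  qed
  have Dh: "\<forall>\<^sub>F g in at_right 0. set_integrable lebesgue D (h g) \<and> (LINT x:D|lebesgue. h g x)
      = (LINT x:{x. \<bar>x - a\<bar> < r}|lebesgue. h g x) + (LINT x:W|lebesgue. h g x)"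
    using h_int[OF r] th(1)
  proof eventually_elim
    case (elim g)
    show ?case using set_integrable_Un[OF elim ball Wl] set_integral_Un[OF D_eq(2) elim]
      unfolding D_eq(1)[symmetric] by simp
  qed
  show "\<forall>\<^sub>F g in at_right 0. set_integrable lebesgue D (\<lambda>x. \<rho> x g * exp (- (\<phi> x / g)))"
    using Df unfolding f_def by (rule eventually_mono) blast
  show "\<forall>\<^sub>F g in at_right 0.
      set_integrable lebesgue D (\<lambda>x. \<rho> x g * ((\<phi> x / g - 1 / 4) * exp (- (\<phi> x / g))))"
    using Dh unfolding h_def by (rule eventually_mono) blast
  have "(\<lambda>g. ((LINT x:{x. \<bar>x - a\<bar> < r}|lebesgue. f g x) - \<rho>0 * \<kappa> * g powr (1/4))
      + (LINT x:W|lebesgue. f g x)) \<in> O[at_right 0](\<lambda>g. g powr (3/4))"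
    by (rule sum_in_bigo f_val[OF r] tf(2))+
  also have "?this \<longleftrightarrow> (\<lambda>g. (LINT x:D|lebesgue. f g x) - \<rho>0 * \<kappa> * g powr (1/4))
      \<in> O[at_right 0](\<lambda>g. g powr (3/4))"
    by (rule landau_o.big.in_cong) (rule eventually_mono[OF Df], simp)
  finally have Z: "(\<lambda>g. LINT x:D|lebesgue. f g x) \<sim>[at_right 0] (\<lambda>g. \<rho>0 * \<kappa> * g powr (1/4))"
    by (rule equiv)
  have "(\<lambda>g. (LINT x:{x. \<bar>x - a\<bar> < r}|lebesgue. h g x) + (LINT x:W|lebesgue. h g x))
      \<in> O[at_right 0](\<lambda>g. g powr (3/4))"
    by (rule sum_in_bigo h_val[OF r] th(2))+
  also have "?this \<longleftrightarrow> (\<lambda>g. LINT x:D|lebesgue. h g x) \<in> O[at_right 0](\<lambda>g. g powr (3/4))"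
    by (rule landau_o.big.in_cong) (rule eventually_mono[OF Dh], simp)
  finally have H: "(\<lambda>g. LINT x:D|lebesgue. h g x) \<in> O[at_right 0](\<lambda>g. g powr (3/4))" .
  have "\<forall>\<^sub>F g in at_right 0. \<rho>0 * \<kappa> * g powr (1/4) > 0"
    using eventually_at_right_less[of "0::real"] by (rule eventually_mono) (use \<rho>0 \<kappa> in simp)
  with asymp_equiv_eventually_pos_iff[OF Z]
  have pos: "\<forall>\<^sub>F g in at_right 0. (LINT x:D|lebesgue. f g x) > 0"
    by eventually_elim simp
  thus "\<forall>\<^sub>F g in at_right 0. (LINT x:D|lebesgue. \<rho> x g * exp (- (\<phi> x / g))) > 0"
    unfolding f_def .
  have "(\<lambda>g. (LINT x:D|lebesgue. h g x) / (LINT x:D|lebesgue. f g x))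
      \<in> O[at_right 0](\<lambda>g. g powr (3/4) / (\<rho>0 * \<kappa> * g powr (1/4)))"
  proof (rule landau_o.big.divide[OF _ _ H])
    show "\<forall>\<^sub>F g in at_right 0. (LINT x:D|lebesgue. f g x) \<noteq> 0"
      using pos by (rule eventually_mono) simp
    show "\<forall>\<^sub>F g in at_right 0. \<rho>0 * \<kappa> * g powr (1/4) \<noteq> 0"
      using eventually_at_right_less[of "0::real"] by (rule eventually_mono) (use \<rho>0 \<kappa> in simp)
    show "(\<lambda>g. \<rho>0 * \<kappa> * g powr (1/4)) \<in> O[at_right 0](\<lambda>g. LINT x:D|lebesgue. f g x)"
      using asymp_equiv_imp_bigo[OF asymp_equiv_symI[OF Z]] .
  qed
  also have "(\<lambda>g. g powr (3/4) / (\<rho>0 * \<kappa> * g powr (1/4))) \<in> O[at_right 0](\<lambda>g. g powr (1/2))"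
    using \<rho>0 \<kappa> by real_asymp
  finally show "(\<lambda>g. (LINT x:D|lebesgue. \<rho> x g * ((\<phi> x / g - 1 / 4) * exp (- (\<phi> x / g)))) /
        (LINT x:D|lebesgue. \<rho> x g * exp (- (\<phi> x / g)))) \<in> O[at_right 0](\<lambda>g. g powr (1/2))"
    unfolding f_def h_def .
qed

section \<open>The critical ensemble\<close>

theorem mainTheorem3:
  fixes X :: "real set" and T\<^sub>H :: "real \<Rightarrow> real" and T\<^sub>c x\<^sub>c :: real
  shows
    "(\<forall>M S. reduced_ensemble X M S T\<^sub>H \<longrightarrow>
        (\<forall>T\<^sub>E. \<forall>x\<in>X.
           (F_gen M S T\<^sub>E has_real_derivative (T\<^sub>H x - T\<^sub>E) * deriv S x) (at x)) \<and>
        (ordinary_critical_point X S T\<^sub>H T\<^sub>c x\<^sub>c \<longrightarrow>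
           deriv (F_gen M S T\<^sub>c) x\<^sub>c = 0 \<and>
           (deriv ^^ 2) (F_gen M S T\<^sub>c) x\<^sub>c = 0 \<and>
           (deriv ^^ 3) (F_gen M S T\<^sub>c) x\<^sub>c = 0 \<and>
           (deriv ^^ 4) (F_gen M S T\<^sub>c) x\<^sub>c = (deriv ^^ 3) T\<^sub>H x\<^sub>c * deriv S x\<^sub>c \<and>
           (deriv ^^ 4) (F_gen M S T\<^sub>c) x\<^sub>c > 0)) \<and>
     (\<forall>(M :: real \<Rightarrow> real \<Rightarrow> real) (S :: real \<Rightarrow> real \<Rightarrow> real) m s g\<^sub>0 D \<rho> N.
        0 < g\<^sub>0 \<longrightarrow>
        smooth_fun_on X m \<longrightarrow> smooth_fun_on X s \<longrightarrow>
        (\<forall>g. M g = (\<lambda>x. m x / g)) \<longrightarrow> (\<forall>g. S g = (\<lambda>x. s x / g)) \<longrightarrow>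
        (\<forall>g\<in>{0<..<g\<^sub>0}. reduced_ensemble X (M g) (S g) T\<^sub>H \<and>
           ordinary_critical_point X (S g) T\<^sub>H T\<^sub>c x\<^sub>c) \<longrightarrow>
        0 < T\<^sub>c \<longrightarrow>
        is_interval D \<longrightarrow> D \<subseteq> X \<longrightarrow>
        regular_density D x\<^sub>c g\<^sub>0 \<rho> N \<longrightarrow>
        unique_dominant_interior_minimum D x\<^sub>c \<rho>
          (\<lambda>g. euclidean_action (F_gen (M g) (S g) T\<^sub>c) T\<^sub>c) \<longrightarrow>
        (\<lambda>g. normalized_average D (\<lambda>x. \<rho> x g) (F_gen (M g) (S g) T\<^sub>c) T\<^sub>c
              - F_gen (M g) (S g) T\<^sub>c x\<^sub>c - T\<^sub>c / 4)
          \<in> O[at_right 0](\<lambda>g. T\<^sub>c * g powr (1/2)) \<and>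
        (\<forall>\<^sub>F r in at_right 0. \<exists>K>0.
          (\<lambda>g. Z_loc x\<^sub>c r (N g) (\<lambda>x. \<rho> x g) (F_gen (M g) (S g) T\<^sub>c) T\<^sub>c
                * exp (F_gen (M g) (S g) T\<^sub>c x\<^sub>c / T\<^sub>c) / N g)
            \<sim>[at_right 0] (\<lambda>g. K * g powr (1/4))))"

proof (rule conjI, goal_cases)
  case 1
  show ?case
  proof (intro conjI allI impI, goal_cases)
    case (1 M S T\<^sub>E)
    thus ?case using has_derivative_F_gen by blast
  next
    case (2 M S)
    thus ?case using F_gen_ordinary_critical_point(1) by blast
  next
    case (3 M S)
    thus ?case using F_gen_ordinary_critical_point(2) by blast
  next
    case (4 M S)
    thus ?case using F_gen_ordinary_critical_point(3) by blast
  next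
    case (5 M S)
    thus ?case using F_gen_ordinary_critical_point(4) by blast
  next
    case (6 M S)
    thus ?case using F_gen_ordinary_critical_point(4)[OF 6]
      by (simp add: ordinary_critical_point_def)
  qed
next
  case 2
  show ?case
  proof (intro allI impI, goal_cases)
    case (1 M S m s g\<^sub>0 D \<rho> N)
    note g0 = 1(1) and smooth = 1(2,3) and M = 1(4)[rule_format] and S = 1(5)[rule_format]
      and ens = 1(6) and Tc = 1(7) and D = 1(8,9) and density = 1(10) and dominant = 1(11)
    \<comment> \<open>\<open>f n\<close> is the \<open>n\<close>-th derivative of \<open>g\<close>
      times the free energy and so does not depend on \<open>g\<close>. With \<phi> normalised in
      this way, the action exceeds its critical value by exactly
      \<open>\<phi> x / g\<close>.\<close>
    define f where "f n x = (deriv ^^ n) m x - T\<^sub>c * (deriv ^^ n) s x" for n x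
    define \<phi> where "\<phi> x = (f 0 x - f 0 x\<^sub>c) / T\<^sub>c" for x
    define F where "F g = F_gen (M g) (S g) T\<^sub>c" for g
    \<comment> \<open>Any admissible value would do: the conditions at the critical point for this
      single parameter determine those on \<open>f\<close>, which is independent of it.\<close>
    define g\<^sub>1 where "g\<^sub>1 = g\<^sub>0 / 2"
    have g1: "g\<^sub>1 > 0" "g\<^sub>1 \<in> {0<..<g\<^sub>0}" using g0 by (simp_all add: g\<^sub>1_def)
    have e1: "reduced_ensemble X (M g\<^sub>1) (S g\<^sub>1) T\<^sub>H" "ordinary_critical_point X (S g\<^sub>1) T\<^sub>H T\<^sub>c x\<^sub>c"
      using ens g1(2) by auto
    have X: "open X" "x\<^sub>c \<in> X"
      using e1 by (auto simp: reduced_ensemble_def ordinary_critical_point_def)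
    have df: "(f n has_real_derivative f (Suc n) x) (at x)" if "x \<in> X" for n x
      unfolding f_def
      by (intro DERIV_diff DERIV_cmult smooth_fun_on_has_derivative[OF smooth(1) X(1) that]
          smooth_fun_on_has_derivative[OF smooth(2) X(1) that])
    have F_deriv: "(deriv ^^ n) (F g\<^sub>1) x\<^sub>c = f n x\<^sub>c / g\<^sub>1" for n
      unfolding F_def M S f_def using smooth X by (intro F_gen_iterated_deriv[of X]) auto
    have crit: "f 1 x\<^sub>c = 0" "f 2 x\<^sub>c = 0" "f 3 x\<^sub>c = 0"
      using F_deriv[of 1] F_deriv[of 2] F_deriv[of 3] F_gen_ordinary_critical_point(1-3)[OF e1] g1(1)
      unfolding F_def by simp_all
    have "(deriv ^^ 4) (F g\<^sub>1) x\<^sub>c > 0"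
      using F_gen_ordinary_critical_point(4)[OF e1] e1(2)
      unfolding F_def by (simp add: ordinary_critical_point_def)
    hence f4: "f 4 x\<^sub>c > 0" using F_deriv[of 4] g1(1) by (simp add: zero_less_divide_iff)
    \<comment> \<open>The Taylor coefficients of \<phi> of order four and five, with 24 and 120 the
      factorials.\<close>
    define \<alpha> where "\<alpha> = f 4 x\<^sub>c / (24 * T\<^sub>c)"
    define \<beta> where "\<beta> = f 5 x\<^sub>c / (120 * T\<^sub>c)"
    have \<alpha>: "\<alpha> > 0" using f4 Tc by (simp add: \<alpha>_def)
    obtain r E where r: "r > 0" and E: "E \<ge> 0"
      and ex: "\<And>x. \<bar>x - x\<^sub>c\<bar> \<le> r \<Longrightarrow> \<exists>q. f 0 x - f 0 x\<^sub>c = (x - x\<^sub>c) ^ 4 * q \<and>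
        \<bar>q - (f 4 x\<^sub>c / 24 + f 5 x\<^sub>c / 120 * (x - x\<^sub>c))\<bar> \<le> E * (x - x\<^sub>c)\<^sup>2"
      using quartic_expansion[OF X df crit] by blast
    have expansion: "\<forall>x. \<bar>x - x\<^sub>c\<bar> \<le> r \<longrightarrow> (\<exists>q. \<phi> x = (x - x\<^sub>c) ^ 4 * q \<and>
        \<bar>q - (\<alpha> + \<beta> * (x - x\<^sub>c))\<bar> \<le> E / T\<^sub>c * (x - x\<^sub>c)\<^sup>2)"
    proof (intro allI impI)
      fix x assume near: "\<bar>x - x\<^sub>c\<bar> \<le> r"
      obtain q where q: "f 0 x - f 0 x\<^sub>c = (x - x\<^sub>c) ^ 4 * q"
        "\<bar>q - (f 4 x\<^sub>c / 24 + f 5 x\<^sub>c / 120 * (x - x\<^sub>c))\<bar> \<le> E * (x - x\<^sub>c)\<^sup>2"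
        using ex[OF near] by blast
      have "q / T\<^sub>c - (\<alpha> + \<beta> * (x - x\<^sub>c)) = (q - (f 4 x\<^sub>c / 24 + f 5 x\<^sub>c / 120 * (x - x\<^sub>c))) / T\<^sub>c"
        using Tc by (simp add: \<alpha>_def \<beta>_def diff_divide_distrib add_divide_distrib)
      hence "\<bar>q / T\<^sub>c - (\<alpha> + \<beta> * (x - x\<^sub>c))\<bar> \<le> E / T\<^sub>c * (x - x\<^sub>c)\<^sup>2"
        using divide_right_mono[OF q(2), of T\<^sub>c] Tc by (simp add: abs_divide)
      thus "\<exists>q. \<phi> x = (x - x\<^sub>c) ^ 4 * q \<and>
          \<bar>q - (\<alpha> + \<beta> * (x - x\<^sub>c))\<bar> \<le> E / T\<^sub>c * (x - x\<^sub>c)\<^sup>2"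
        using q(1) by (intro exI[of _ "q / T\<^sub>c"]) (simp add: \<phi>_def)
    qed
    have "continuous_on X (f 0)"
      by (rule DERIV_continuous_on[OF has_field_derivative_at_within[OF df]])
    hence \<phi>: "continuous_on X \<phi>"
      unfolding \<phi>_def by (intro continuous_intros) (use Tc in auto)
    have F_eq: "F g x = F g x\<^sub>c + T\<^sub>c * (\<phi> x / g)" for g x
    proof -
      have "F g x = f 0 x / g" for x
        by (simp add: F_def F_gen_def M S f_def diff_divide_distrib)
      thus ?thesis using Tc by (simp add: \<phi>_def diff_divide_distrib[of _ _ g])
    qed
    \<comment> \<open>The Boltzmann factor of the critical value does not depend on
      \<open>x\<close>. It cancels in the average, and in the local partition function it is
      compensated by \<open>exp (F g x\<^sub>c / T\<^sub>c)\<close>.\<close>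
    define W where "W g = exp (- (F g x\<^sub>c / T\<^sub>c))" for g
    have W: "W g > 0" for g by (simp add: W_def)
    have exp_eq: "exp (- euclidean_action (F g) T\<^sub>c x) = W g * exp (- (\<phi> x / g))" for g x
      using Tc by (subst euclidean_action_def, subst F_eq) (simp add: W_def add_divide_distrib mult_exp_exp)
    have I: "euclidean_action (F g) T\<^sub>c x - euclidean_action (F g) T\<^sub>c x\<^sub>c = \<phi> x / g" for g x
      using Tc F_eq[of g x] by (simp add: euclidean_action_def add_divide_distrib)
    have ET: "E / T\<^sub>c \<ge> 0" using E Tc by simp
    note laplace = quartic_laplace_average[OF density g0 dominant[folded F_def] I D X(1) \<phi> \<alpha> r ET expansion]
    define A where "A g = (LINT x:D|lebesgue. \<rho> x g * ((\<phi> x / g - 1 / 4) * exp (- (\<phi> x / g))))" for g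
    define Z where "Z g = (LINT x:D|lebesgue. \<rho> x g * exp (- (\<phi> x / g)))" for g
    \<comment> \<open>An exact identity: with \<open>u = \<phi> x / g\<close> the free energy is
      \<open>F g x\<^sub>c + T\<^sub>c / 4 + T\<^sub>c * (u - 1 / 4)\<close>, and the constant part
      averages to itself. It is claimed for small \<open>g\<close>, where the two integrals may be
      separated and \<open>Z g\<close> is positive.\<close>
    have avg: "\<forall>\<^sub>F g in at_right 0. normalized_average D (\<lambda>x. \<rho> x g) (F g) T\<^sub>c - F g x\<^sub>c - T\<^sub>c / 4
        = T\<^sub>c * (A g / Z g)"
      using laplace(1-3)
    proof eventually_elim
      case (elim g)
      have "(LINT x:D|lebesgue. \<rho> x g * F g x * exp (- euclidean_action (F g) T\<^sub>c x))
          = (LINT x:D|lebesgue. W g * (F g x\<^sub>c + T\<^sub>c / 4) * (\<rho> x g * exp (- (\<phi> x / g)))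
              + W g * T\<^sub>c * (\<rho> x g * ((\<phi> x / g - 1 / 4) * exp (- (\<phi> x / g)))))"
        unfolding exp_eq by (subst F_eq) (simp add: algebra_simps)
      also have "\<dots> = W g * (F g x\<^sub>c + T\<^sub>c / 4) * Z g + W g * T\<^sub>c * A g"
        unfolding A_def Z_def using elim(1,2) by (subst set_integral_add(2)) simp_all
      finally have num: "(LINT x:D|lebesgue. \<rho> x g * F g x * exp (- euclidean_action (F g) T\<^sub>c x))
          = W g * (F g x\<^sub>c + T\<^sub>c / 4) * Z g + W g * T\<^sub>c * A g" .
      have den: "(LINT x:D|lebesgue. \<rho> x g * exp (- euclidean_action (F g) T\<^sub>c x)) = W g * Z g"
        unfolding exp_eq Z_def by (simp add: mult.left_commute)
      have Zpos: "Z g > 0" using elim(3) by (simp add: Z_def)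
      show ?case
        unfolding normalized_average_def num den using Zpos W[of g] by (simp add: field_simps)
    qed
    have "(\<lambda>g. T\<^sub>c * (A g / Z g)) \<in> O[at_right 0](\<lambda>g. T\<^sub>c * g powr (1/2))"
      unfolding A_def Z_def by (rule landau_o.big.mult[OF landau_o.big_refl laplace(4)])
    also have "?this \<longleftrightarrow> (\<lambda>g. normalized_average D (\<lambda>x. \<rho> x g) (F g) T\<^sub>c - F g x\<^sub>c - T\<^sub>c / 4)
        \<in> O[at_right 0](\<lambda>g. T\<^sub>c * g powr (1/2))"
      by (rule landau_o.big.in_cong) (rule eventually_mono[OF avg], simp)
    finally have average: "(\<lambda>g. normalized_average D (\<lambda>x. \<rho> x g) (F g) T\<^sub>c - F g x\<^sub>c - T\<^sub>c / 4)
        \<in> O[at_right 0](\<lambda>g. T\<^sub>c * g powr (1/2))" .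
    \<comment> \<open>The bound variable \<open>r\<close> is now the radius of the window, not the
      radius of the Taylor expansion above.\<close>
    have Zloc: "\<forall>\<^sub>F g in at_right 0. Z_loc x\<^sub>c r (N g) (\<lambda>x. \<rho> x g) (F g) T\<^sub>c * exp (F g x\<^sub>c / T\<^sub>c) / N g
        = (LINT x:{x. \<bar>x - x\<^sub>c\<bar> < r}|lebesgue. \<rho> x g * exp (- (\<phi> x / g)))" for r
      using eventually_at_right_real[OF g0]
    proof eventually_elim
      case (elim g)
      have N: "N g > 0" using density elim unfolding regular_density_def by blast
      have "Z_loc x\<^sub>c r (N g) (\<lambda>x. \<rho> x g) (F g) T\<^sub>c
          = (LINT x:{x. \<bar>x - x\<^sub>c\<bar> < r}|lebesgue. N g * W g * (\<rho> x g * exp (- (\<phi> x / g))))"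
        unfolding Z_loc_def exp_eq by (simp add: mult_ac)
      also have "\<dots> = N g * W g * (LINT x:{x. \<bar>x - x\<^sub>c\<bar> < r}|lebesgue. \<rho> x g * exp (- (\<phi> x / g)))"
        by simp
      finally show ?case using N by (simp add: W_def exp_minus)
    qed
    have "\<forall>\<^sub>F r in at_right 0. \<exists>K>0.
        (\<lambda>g. Z_loc x\<^sub>c r (N g) (\<lambda>x. \<rho> x g) (F g) T\<^sub>c * exp (F g x\<^sub>c / T\<^sub>c) / N g)
          \<sim>[at_right 0] (\<lambda>g. K * g powr (1/4))"
      using laplace(5)
    proof eventually_elim
      case (elim r)
      thus ?case using asymp_equiv_cong[OF Zloc[of r] eventually_mono[OF eventually_True]] by blast
    qed
    with average show ?case unfolding F_def by blast
  qed
qed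

end
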